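(* Let $L$ be a convex body in $\mathbb{R}^d$ with the origin as an interior point, and let $X(t)$, $t\ge 0$, be a symmetric $\alpha$-stable Lévy process in $\mathbb{R}^d$ with $\alpha\in(1,2)$ such that $\langle X(t),u\rangle$ is nondegenerate for all $u\ne 0$ (and $t>0$). Let $Z$ be the closed convex hull of $\{X(t):0\le t\le 1\}$. Then, for all $p\in[1,\alpha)$, $$\mathbf{E}\,V_p(L,Z)=\mathbf{E}\Big(\sup_{0\le t\le 1}R(t)\Big)^p\,V_p(L,K),$$ where $R(t)$, $t\ge0$, is a symmetric $\alpha$-stable Lévy process in $\mathbb{R}$ with the same parameter $\alpha$ as $X$ and scale parameter $1$, and $K$ is the associated zonoid of $X(1)$.
   Context: All Lévy processes start at the origin. A convex body is a non-empty compact convex set in $\mathbb{R}^d$, with support function $h(K,u)=\sup\{\langle x,u\rangle:x\in K\}$. For convex bodies $L,M$ containing the origin and $p\in[1,\infty)$, the $L_p$-sum $L+_pM$ is the convex body with $h(L+_pM,u)^p=h(L,u)^p+h(M,u)^p$, $u\in\mathbb{R}^d$. For convex bodies $L,M$ with the origin as an interior point, $V_p(L,M)=\frac{p}{d}\lim_{t\downarrow 0}\frac{V_d(L+_pt^{1/p}M)-V_d(L)}{t}$, where $V_d$ is Lebesgue measure. (Under the hypotheses $Z$ almost surely has the origin as an interior point.) The associated zonoid of $X(1)$ is the convex body $K$ such that $\mathbf{E}\exp\{\imath\langle X(t),u\rangle\}=\exp\{-t\,h(K,u)^\alpha\}$ for all $u\in\mathbb{R}^d$, $t\ge0$. Scale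 parameter $1$ means $\mathbf{E}\exp\{\imath sR(t)\}=\exp\{-t|s|^\alpha\}$ for $s\in\mathbb{R}$, $t\ge0$. The factor $\mathbf{E}(\sup_{0\le t\le 1}R(t))^p$ is the expectation of the $p$-th power of the supremum. *)

theory Defs
  imports "HOL-Probability.Probability"
begin

definition convex_body :: "'d::euclidean_space set \<Rightarrow> bool" where
  "convex_body K \<longleftrightarrow> K \<noteq> {} \<and> compact K \<and> convex K"

definition support_fun :: "'d::euclidean_space set \<Rightarrow> 'd \<Rightarrow> real" where
  "support_fun K u = (SUP x\<in>K. x \<bullet> u)"

text \<open>
  For convex bodies containing the origin, \<open>Lp_sum p L M\<close> is the body \<open>L +\<^sub>p M\<close>.
  The condition \<open>0 \<in> S\<close> says that the support function of \<open>S\<close> is nonnegative. It is needed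
  because \<open>x powr p = \<bar>x\<bar> powr p\<close> for real \<open>x\<close>: without it a negative value of the support
  function could satisfy the equation.
\<close>

definition Lp_sum :: "real \<Rightarrow> 'd::euclidean_space set \<Rightarrow> 'd set \<Rightarrow> 'd set" where
  "Lp_sum p L M = (THE S. convex_body S \<and> 0 \<in> S \<and>
     (\<forall>u. support_fun S u powr p = support_fun L u powr p + support_fun M u powr p))"

definition Lp_mixed_volume :: "real \<Rightarrow> 'd::euclidean_space set \<Rightarrow> 'd set \<Rightarrow> real" where
  "Lp_mixed_volume p L M = p / real DIM('d) *
     Lim (at_right 0) (\<lambda>t.
       (measure lebesgue (Lp_sum p L ((\<lambda>x. (t powr (1 / p)) *\<^sub>R x) ` M)) - measure lebesgue L) / t)"

definition cadlag :: "(real \<Rightarrow> 'd::euclidean_space) \<Rightarrow> bool" where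
  "cadlag f \<longleftrightarrow> (\<forall>t\<ge>0. continuous (at_right t) f) \<and> (\<forall>t>0. \<exists>l. (f \<longlongrightarrow> l) (at_left t))"

text \<open>
  Stochastic continuity is not listed: it follows from stationarity and right-continuity at \<open>0\<close>.
  Only the values of \<open>X t\<close> for \<open>t \<ge> 0\<close> matter.
\<close>

definition levy_process :: "'a measure \<Rightarrow> (real \<Rightarrow> 'a \<Rightarrow> 'd::euclidean_space) \<Rightarrow> bool" where
  "levy_process M X \<longleftrightarrow>
     prob_space M \<and>
     (\<forall>t\<ge>0. X t \<in> borel_measurable M) \<and>
     (AE \<omega> in M. X 0 \<omega> = 0) \<and>
     (\<forall>n (\<tau>::nat \<Rightarrow> real). 0 \<le> \<tau> 0 \<longrightarrow> (\<forall>i<n. \<tau> i < \<tau> (Suc i)) \<longrightarrow>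
        prob_space.indep_vars M (\<lambda>_. borel) (\<lambda>i \<omega>. X (\<tau> (Suc i)) \<omega> - X (\<tau> i) \<omega>) {..<n}) \<and>
     (\<forall>s\<ge>0. \<forall>t\<ge>0. distr M borel (\<lambda>\<omega>. X (s + t) \<omega> - X s \<omega>) = distr M borel (X t)) \<and>
     (AE \<omega> in M. cadlag (\<lambda>t. X t \<omega>))"

text \<open>
  \<open>P\<close> is stable with index \<open>\<alpha>\<close>: if \<open>\<xi>\<close>, \<open>\<eta>\<close> are independent with law \<open>P\<close>, then for all
  \<open>a, b > 0\<close> the vector \<open>a \<xi> + b \<eta>\<close> has the law of \<open>(a\<^sup>\<alpha> + b\<^sup>\<alpha>)\<^bsup>1/\<alpha>\<^esup> \<xi> + c\<close> for some \<open>c\<close>.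
\<close>

definition stable_law :: "real \<Rightarrow> 'd::euclidean_space measure \<Rightarrow> bool" where
  "stable_law \<alpha> P \<longleftrightarrow> prob_space P \<and> sets P = sets borel \<and>
     (\<forall>a>0. \<forall>b>0. \<exists>c. distr (P \<Otimes>\<^sub>M P) borel (\<lambda>(x, y). a *\<^sub>R x + b *\<^sub>R y) =
        distr P borel (\<lambda>x. ((a powr \<alpha> + b powr \<alpha>) powr (1 / \<alpha>)) *\<^sub>R x + c))"

definition symmetric_law :: "'d::euclidean_space measure \<Rightarrow> bool" where
  "symmetric_law P \<longleftrightarrow> distr P borel uminus = P"

definition symmetric_stable_levy_process ::
    "real \<Rightarrow> 'a measure \<Rightarrow> (real \<Rightarrow> 'a \<Rightarrow> 'd::euclidean_space) \<Rightarrow> bool" where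
  "symmetric_stable_levy_process \<alpha> M X \<longleftrightarrow>
     levy_process M X \<and> stable_law \<alpha> (distr M borel (X 1)) \<and> symmetric_law (distr M borel (X 1))"

text \<open>As in \<open>Lp_sum\<close>, \<open>0 \<in> K\<close> makes the base of the real power nonnegative.\<close>

definition associated_zonoid ::
    "real \<Rightarrow> 'a measure \<Rightarrow> (real \<Rightarrow> 'a \<Rightarrow> 'd::euclidean_space) \<Rightarrow> 'd set \<Rightarrow> bool" where
  "associated_zonoid \<alpha> M X K \<longleftrightarrow> convex_body K \<and> 0 \<in> K \<and>
     (\<forall>u. \<forall>t\<ge>0. (CLINT \<omega>|M. iexp (X t \<omega> \<bullet> u)) =
        complex_of_real (exp (- t * support_fun K u powr \<alpha>)))"

definition scale_parameter_one :: "real \<Rightarrow> 'a measure \<Rightarrow> (real \<Rightarrow> 'a \<Rightarrow> real) \<Rightarrow> bool" where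
  "scale_parameter_one \<alpha> N R \<longleftrightarrow>
     (\<forall>s. \<forall>t\<ge>0. (CLINT \<omega>|N. iexp (s * R t \<omega>)) = complex_of_real (exp (- t * \<bar>s\<bar> powr \<alpha>)))"

definition nondegenerate :: "'a measure \<Rightarrow> ('a \<Rightarrow> real) \<Rightarrow> bool" where
  "nondegenerate M Y \<longleftrightarrow> \<not> (\<exists>c. AE \<omega> in M. Y \<omega> = c)"

definition path_hull :: "(real \<Rightarrow> 'a \<Rightarrow> 'd::euclidean_space) \<Rightarrow> 'a \<Rightarrow> 'd set" where
  "path_hull X \<omega> = closure (convex hull ((\<lambda>t. X t \<omega>) ` {0..1}))"

text \<open>
  Expectations of path functionals are taken with respect to \<open>completion M\<close>: paths are only
  almost surely cadlag and \<open>Lp_mixed_volume p L (path_hull X \<omega>)\<close> is only almost surely given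
  by the definition for bodies with interior origin, so such functionals are determined up to a
  null set that need not be handled by the original \<open>\<sigma>\<close>-algebra. For functions measurable
  with respect to \<open>M\<close> the two integrals agree.
\<close>

end

theory Submission
  imports Defs
begin

text \<open>
  Let \<open>g\<close> be the gauge of \<open>L\<close>, so that \<open>d! V\<^sub>d(L) = \<integral> exp (- g)\<close>. For almost every \<open>x\<close> the maximum
  \<open>g x = max {\<langle>x, u\<rangle> | h(L, u) = 1}\<close> has a unique maximiser \<open>u\<^sub>x\<close>. The gauge of \<open>L +\<^sub>p t\<^bsup>1/p\<^esup> M\<close> is
  the maximum of \<open>\<langle>x, u\<rangle> (1 + t h(M, u)\<^sup>p)\<^bsup>-1/p\<^esup>\<close> over the same \<open>u\<close>, so Danskin's theorem and dominated
  convergence give \<open>V\<^sub>p(L, M) = \<integral> h(M, u\<^sub>x)\<^sup>p exp (- g x) g x dx / (d d!)\<close>: the integral of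
  \<open>h(M, \<cdot>)\<^sup>p\<close> against a finite measure that depends on neither \<open>M\<close> nor \<open>p\<close>.

  By Tonelli's theorem it then suffices to know \<open>E h(Z, u)\<^sup>p\<close>. The increments of \<open>\<langle>X, u\<rangle>\<close> and of
  \<open>h(K, u) R\<close> over a dyadic grid have the same law, and suprema over \<open>[0, 1]\<close> are limits of maxima
  over such grids, so \<open>E h(Z, u)\<^sup>p = h(K, u)\<^sup>p E (sup R)\<^sup>p\<close>. This is finite by Levy's maximal
  inequality, since \<open>E |R(1)|\<^sup>p\<close> is finite for \<open>p < \<alpha>\<close>.
\<close>

section \<open>Support functions and the sum of order p\<close>

text \<open>Writing the volume as an integral of \<open>exp (- g)\<close> keeps the domain of
  integration fixed, so the derivative in t can be taken under the integral. The resulting measure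
  is the cone-volume measure of L, carried to the set where h(L, u) = 1. On that set the usual
  factor h(L, u)^(1-p) equals 1, which is why one measure serves every p. The factor p in the
  definition of V_p cancels the 1/p from differentiating (1 + s)^(-1/p) at 0.

  On the random side the obstacle is measurability: Z is a random set, and its properties hold only
  almost surely. All randomness is therefore carried by an extended-real countable supremum over
  dyadic times, which is jointly measurable in the path and the direction. It agrees with h(Z, u)^p
  outside one null set common to all u. This null set comes from the finitely many directions e and
  -e of the basis: their dyadic suprema have finite expectation, hence are almost surely finite,
  which bounds the path.\<close>

lemma compact_bdd_above_inner:
  fixes K :: "'d::euclidean_space set"
  assumes "compact K"
  shows "bdd_above ((\<lambda>x. x \<bullet> u) ` K)"
  by (intro bounded_imp_bdd_above compact_imp_bounded compact_continuous_image continuous_intros assms)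

lemma inner_le_support_fun:
  assumes "compact K" "x \<in> K"
  shows "x \<bullet> u \<le> support_fun K u"
  unfolding support_fun_def by (intro cSUP_upper assms compact_bdd_above_inner)

lemma support_fun_least:
  assumes "K \<noteq> {}" "\<And>x. x \<in> K \<Longrightarrow> x \<bullet> u \<le> c"
  shows "support_fun K u \<le> c"
  unfolding support_fun_def using assms by (intro cSUP_least)

lemma support_fun_attained:
  fixes K :: "'d::euclidean_space set"
  assumes "compact K" "K \<noteq> {}"
  obtains x where "x \<in> K" "support_fun K u = x \<bullet> u"
proof -
  have "continuous_on K (\<lambda>x. x \<bullet> u)" by (intro continuous_intros)
  from continuous_attains_sup[OF assms this] obtain x where x: "x \<in> K" "\<forall>y\<in>K. y \<bullet> u \<le> x \<bullet> u"
    by auto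
  have "support_fun K u = x \<bullet> u"
    using x assms by (intro antisym support_fun_least inner_le_support_fun) auto
  with x that show ?thesis by blast
qed

lemma support_fun_scaleR:
  fixes K :: "'d::euclidean_space set"
  assumes "compact K" "K \<noteq> {}" "0 \<le> c"
  shows "support_fun K (c *\<^sub>R u) = c * support_fun K u"
proof (rule antisym)
  show "support_fun K (c *\<^sub>R u) \<le> c * support_fun K u"
    using assms by (intro support_fun_least) (auto intro!: mult_left_mono inner_le_support_fun)
  obtain x where "x \<in> K" "support_fun K u = x \<bullet> u"
    using support_fun_attained assms by blast
  then show "c * support_fun K u \<le> support_fun K (c *\<^sub>R u)"
    using inner_le_support_fun[of K x "c *\<^sub>R u"] assms by simp
qed

lemma support_fun_image_scaleR:
  fixes K :: "'d::euclidean_space set"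
  assumes "compact K" "K \<noteq> {}" "0 \<le> c"
  shows "support_fun ((\<lambda>x. c *\<^sub>R x) ` K) u = c * support_fun K u"
proof -
  have "support_fun ((\<lambda>x. c *\<^sub>R x) ` K) u = support_fun K (c *\<^sub>R u)"
    by (simp add: support_fun_def image_image)
  then show ?thesis using assms by (simp add: support_fun_scaleR)
qed

lemma support_fun_lipschitz:
  fixes K :: "'d::euclidean_space set"
  assumes "compact K" "K \<noteq> {}" "\<And>x. x \<in> K \<Longrightarrow> norm x \<le> R"
  shows "\<bar>support_fun K u - support_fun K v\<bar> \<le> R * norm (u - v)"
proof -
  have *: "support_fun K u - support_fun K v \<le> R * norm (u - v)" for u v
  proof -
    obtain x where x: "x \<in> K" "support_fun K u = x \<bullet> u"
      using support_fun_attained assms by blast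
    have "x \<bullet> u - x \<bullet> v \<le> norm x * norm (u - v)"
      by (metis inner_diff_right norm_cauchy_schwarz)
    also have "\<dots> \<le> R * norm (u - v)" using x assms by (intro mult_right_mono) auto
    finally show ?thesis using x inner_le_support_fun[of K x v] assms by simp
  qed
  show ?thesis using *[of u v] *[of v u] by (simp add: norm_minus_commute)
qed

lemma continuous_on_support_fun [continuous_intros]:
  fixes K :: "'d::euclidean_space set"
  assumes "compact K" "K \<noteq> {}"
  shows "continuous_on A (support_fun K)"
proof -
  obtain R where R: "\<And>x. x \<in> K \<Longrightarrow> norm x \<le> R" "0 < R"
    using compact_imp_bounded[OF assms(1)] by (meson bounded_pos)
  have "R-lipschitz_on UNIV (support_fun K)"
    using support_fun_lipschitz[OF assms R(1)] R(2) by (intro lipschitz_onI) (auto simp: dist_norm)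
  then show ?thesis
    using lipschitz_on_continuous_on continuous_on_subset by blast
qed

lemma measurable_support_fun:
  fixes K :: "'d::euclidean_space set"
  assumes "compact K" "K \<noteq> {}"
  shows "support_fun K \<in> borel_measurable borel"
  by (intro borel_measurable_continuous_onI continuous_on_support_fun assms)

text \<open>A point outside the closed convex set is strictly separated from it, and the normal of
  the separating hyperplane violates the inequality. This is why a body is determined by its support
  function.\<close>

lemma mem_iff_inner_le_support_fun:
  assumes "convex_body K"
  shows "x \<in> K \<longleftrightarrow> (\<forall>u. x \<bullet> u \<le> support_fun K u)"
proof
  show "x \<in> K \<Longrightarrow> \<forall>u. x \<bullet> u \<le> support_fun K u"
    using assms inner_le_support_fun unfolding convex_body_def by blast
  assume le: "\<forall>u. x \<bullet> u \<le> support_fun K u"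
  show "x \<in> K"
  proof (rule ccontr)
    assume "x \<notin> K"
    then obtain a b where ab: "a \<bullet> x < b" "\<forall>y\<in>K. a \<bullet> y > b"
      using separating_hyperplane_closed_point[of K x] assms compact_imp_closed
      unfolding convex_body_def by blast
    have "support_fun K (- a) \<le> - b"
      using ab assms unfolding convex_body_def
      by (intro support_fun_least) (auto simp: inner_commute less_imp_le)
    then show False using le ab(1) by (metis inner_commute inner_minus_right less_le_not_le neg_le_iff_le order_trans)
  qed
qed

lemma convex_body_eqI:
  assumes "convex_body K" "convex_body K'" "\<And>u. support_fun K u = support_fun K' u"
  shows "K = K'"
  using assms by (auto simp: mem_iff_inner_le_support_fun)

lemma support_fun_nonneg:
  assumes "compact K" "0 \<in> K"
  shows "0 \<le> support_fun K u"
  using inner_le_support_fun[OF assms, of u] by simp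

lemma powr_convex_combination_le:
  fixes a b \<theta> \<mu> p :: real
  assumes "0 < \<theta>" "0 < \<mu>" "\<theta> + \<mu> = 1" "0 \<le> a" "0 \<le> b" "1 \<le> p"
  shows "(\<theta> * a + \<mu> * b) powr p \<le> \<theta> * a powr p + \<mu> * b powr p"
proof -
  \<comment> \<open>If a or b vanishes, the claim reduces to this inequality for the remaining
    weight.\<close>
  have le: "c powr p \<le> c" if "0 < c" "c \<le> 1" for c :: real
    using powr_mono'[of 1 p c] that assms by simp
  consider "a = 0" | "b = 0" | "0 < a" "0 < b" using assms by linarith
  then show ?thesis
  proof cases
    case 3
    have "(\<theta> *\<^sub>R a + \<mu> *\<^sub>R b) powr p \<le> \<theta> * a powr p + \<mu> * b powr p"
      using powr_convex[OF assms(6)] 3 assms unfolding convex_on_def by auto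
    then show ?thesis by simp
  qed (use assms le[of \<theta>] le[of \<mu>] in \<open>auto simp: powr_mult intro!: mult_right_mono\<close>)
qed

text \<open>Equality case of Hoelder's inequality: (a, b) is a functional of dual norm at most 1
  attaining the l_p norm N at (s, t). For positive s and t it is the gradient ((s/N)^(p-1),
  (t/N)^(p-1)) of the norm. No conjugate exponent is involved, so p = 1 is included.\<close>

lemma Lp_sum_coefficients:
  fixes s t p :: real
  assumes "0 \<le> s" "0 \<le> t" "1 \<le> p"
  obtains a b where "0 \<le> a" "0 \<le> b" "a * s + b * t = (s powr p + t powr p) powr (1 / p)"
    "\<And>s' t'. 0 \<le> s' \<Longrightarrow> 0 \<le> t' \<Longrightarrow> a * s' + b * t' \<le> (s' powr p + t' powr p) powr (1 / p)"
proof -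
  have root: "x = (x powr p) powr (1 / p)" if "0 \<le> x" for x
    using that assms by (simp add: powr_powr)
  consider "s = 0" | "t = 0" | "0 < s" "0 < t" using assms by linarith
  then show ?thesis
  proof cases
    case 1
    have "t' \<le> (s' powr p + t' powr p) powr (1 / p)" if "0 \<le> s'" "0 \<le> t'" for s' t'
      using that assms by (subst root[of t']) (auto intro!: powr_mono2)
    then show ?thesis using 1 root[of t] assms by (intro that[of 0 1]) auto
  next
    case 2
    have "s' \<le> (s' powr p + t' powr p) powr (1 / p)" if "0 \<le> s'" "0 \<le> t'" for s' t'
      using that assms by (subst root[of s']) (auto intro!: powr_mono2)
    then show ?thesis using 2 root[of s] assms by (intro that[of 1 0]) auto
  next
    case 3
    define n where "n = s powr p + t powr p"
    define N where "N = n powr (1 / p)"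
    define \<theta> where "\<theta> = s powr p / n"
    define \<mu> where "\<mu> = t powr p / n"
    have n: "0 < n" "0 < s powr p" "0 < t powr p" using 3 by (auto simp: n_def add_pos_pos)
    have pos: "0 < \<theta>" "0 < \<mu>" "0 < N" using n by (auto simp: \<theta>_def \<mu>_def N_def)
    have sum: "\<theta> + \<mu> = 1" using n(1) by (simp add: \<theta>_def \<mu>_def add_divide_distrib[symmetric] n_def[symmetric])
    have Np: "N powr p = n" using n assms by (simp add: N_def powr_powr)
    \<comment> \<open>Convexity of x^p with weights \<theta> and \<mu> is applied to the ratios s'/s
      and t'/t; the powers of s and t in the weights cancel the denominators.\<close>
    have "N * \<theta> / s * s' + N * \<mu> / t * t' \<le> (s' powr p + t' powr p) powr (1 / p)"
      if st: "0 \<le> s'" "0 \<le> t'" for s' t'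
    proof -
      let ?c = "\<theta> * (s' / s) + \<mu> * (t' / t)"
      have c: "0 \<le> ?c" using st 3 pos by (intro add_nonneg_nonneg mult_nonneg_nonneg) auto
      have "(N * ?c) powr p = n * ?c powr p" using c pos Np by (simp add: powr_mult)
      also have "\<dots> \<le> n * (\<theta> * (s' / s) powr p + \<mu> * (t' / t) powr p)"
        using powr_convex_combination_le[OF pos(1,2) sum, of "s' / s" "t' / t" p] st 3 n assms
        by (intro mult_left_mono) auto
      also have "\<dots> = s' powr p + t' powr p"
        using n 3 st unfolding \<theta>_def \<mu>_def by (simp add: powr_divide field_simps)
      finally have "((N * ?c) powr p) powr (1 / p) \<le> (s' powr p + t' powr p) powr (1 / p)"
        using assms by (intro powr_mono2) auto
      moreover have "((N * ?c) powr p) powr (1 / p) = N * ?c"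
        using root[of "N * ?c"] c pos by simp
      ultimately show ?thesis by (simp add: algebra_simps)
    qed
    moreover have "N * \<theta> / s * s + N * \<mu> / t * t = N * (\<theta> + \<mu>)" using 3 by (simp add: algebra_simps)
    ultimately show ?thesis
      using pos 3 sum by (intro that[of "N * \<theta> / s" "N * \<mu> / t"]) (auto simp: N_def n_def)
  qed
qed

text \<open>The generating set is the pointwise description of the \<open>L\<^sub>p\<close>-sum due to Lutwak, Yang and
  Zhang, with the dual unit ball of \<open>\<ell>\<^sub>p\<close> as coefficients.\<close>

lemma Lp_sum_exists:
  fixes L M :: "'d::euclidean_space set"
  assumes L: "convex_body L" "0 \<in> L" and M: "convex_body M" "0 \<in> M" and p: "1 \<le> p"
  obtains S where "convex_body S" "0 \<in> S"
    "\<And>u. support_fun S u = (support_fun L u powr p + support_fun M u powr p) powr (1 / p)"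
proof -
  \<comment> \<open>The dual ball is described by polarity, which again avoids the infinite
    conjugate exponent at p = 1.\<close>
  define Q where "Q = {(a::real, b::real). 0 \<le> a \<and> 0 \<le> b \<and>
    (\<forall>s\<ge>0. \<forall>t\<ge>0. a * s + b * t \<le> (s powr p + t powr p) powr (1 / p))}"
  define T where "T = {a *\<^sub>R x + b *\<^sub>R y | a b x y. (a, b) \<in> Q \<and> x \<in> L \<and> y \<in> M}"
  \<comment> \<open>Passing to the closed convex hull does not change the suprema of linear
    functionals, so T itself need not be shown convex or closed.\<close>
  define S where "S = closure (convex hull T)"
  have cL: "compact L" "L \<noteq> {}" and cM: "compact M" "M \<noteq> {}"
    using L M by (auto simp: convex_body_def)
  obtain A where A: "\<And>x. x \<in> L \<Longrightarrow> norm x \<le> A" using compact_imp_bounded[OF cL(1)] by (meson bounded_pos)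
  obtain B where B: "\<And>x. x \<in> M \<Longrightarrow> norm x \<le> B" using compact_imp_bounded[OF cM(1)] by (meson bounded_pos)
  have le1: "0 \<le> a \<and> a \<le> 1 \<and> 0 \<le> b \<and> b \<le> 1" if "(a, b) \<in> Q" for a b
  proof -
    have "a * s + b * t \<le> (s powr p + t powr p) powr (1 / p)" if "0 \<le> s" "0 \<le> t" for s t
      using that \<open>(a, b) \<in> Q\<close> by (auto simp: Q_def)
    from this[of 1 0] this[of 0 1] show ?thesis using that by (auto simp: Q_def)
  qed
  have "norm z \<le> A + B" if "z \<in> T" for z
  proof -
    obtain a b x y where z: "z = a *\<^sub>R x + b *\<^sub>R y" "(a, b) \<in> Q" "x \<in> L" "y \<in> M"
      using \<open>z \<in> T\<close> unfolding T_def by blast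
    have "norm z \<le> a * norm x + b * norm y"
      using le1[OF z(2)] norm_triangle_ineq[of "a *\<^sub>R x" "b *\<^sub>R y"] by (simp add: z(1))
    also have "\<dots> \<le> 1 * norm x + 1 * norm y"
      using le1[OF z(2)] by (intro add_mono mult_right_mono) auto
    finally show ?thesis using A[OF z(3)] B[OF z(4)] by simp
  qed
  then have "bounded T" by (auto simp: bounded_iff)
  then have cS: "compact S" unfolding S_def by (simp add: bounded_convex_hull)
  have TS: "T \<subseteq> S" unfolding S_def using closure_subset hull_subset by (metis subset_trans)
  have "(0, 0) \<in> Q" by (auto simp: Q_def)
  then have "0 \<in> T" unfolding T_def using L M by force
  with TS have 0: "0 \<in> S" by auto
  have "support_fun S u = (support_fun L u powr p + support_fun M u powr p) powr (1 / p)" (is "_ = ?H")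
    for u
  proof (rule antisym)
    have "z \<bullet> u \<le> ?H" if "z \<in> T" for z
    proof -
      obtain a b x y where z: "z = a *\<^sub>R x + b *\<^sub>R y" "(a, b) \<in> Q" "x \<in> L" "y \<in> M"
        using \<open>z \<in> T\<close> unfolding T_def by blast
      have "z \<bullet> u = a * (x \<bullet> u) + b * (y \<bullet> u)" by (simp add: z(1) inner_add_left)
      also have "\<dots> \<le> a * support_fun L u + b * support_fun M u"
        using le1[OF z(2)] z cL cM by (intro add_mono mult_left_mono inner_le_support_fun) auto
      also have "\<dots> \<le> ?H"
        using z(2) support_fun_nonneg[OF cL(1) L(2)] support_fun_nonneg[OF cM(1) M(2)]
        by (auto simp: Q_def)
      finally show ?thesis .
    qed
    then have "T \<subseteq> {z. u \<bullet> z \<le> ?H}" by (auto simp: inner_commute)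
    then have "S \<subseteq> {z. u \<bullet> z \<le> ?H}" unfolding S_def
      by (intro closure_minimal hull_minimal closed_halfspace_le convex_halfspace_le)
    then show "support_fun S u \<le> ?H"
      using 0 by (intro support_fun_least) (auto simp: inner_commute)
    obtain a b where ab: "0 \<le> a" "0 \<le> b" "a * support_fun L u + b * support_fun M u = ?H"
      "\<And>s' t'. 0 \<le> s' \<Longrightarrow> 0 \<le> t' \<Longrightarrow> a * s' + b * t' \<le> (s' powr p + t' powr p) powr (1 / p)"
      using Lp_sum_coefficients[of "support_fun L u" "support_fun M u" p]
        support_fun_nonneg[OF cL(1) L(2)] support_fun_nonneg[OF cM(1) M(2)] p by blast
    obtain x where x: "x \<in> L" "support_fun L u = x \<bullet> u" using support_fun_attained cL by blast
    obtain y where y: "y \<in> M" "support_fun M u = y \<bullet> u" using support_fun_attained cM by blast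
    have "(a, b) \<in> Q" using ab by (auto simp: Q_def)
    then have "a *\<^sub>R x + b *\<^sub>R y \<in> T" using x y unfolding T_def by blast
    then have "a *\<^sub>R x + b *\<^sub>R y \<in> S" using TS by auto
    then have "(a *\<^sub>R x + b *\<^sub>R y) \<bullet> u \<le> support_fun S u" using cS by (intro inner_le_support_fun)
    then show "?H \<le> support_fun S u" using ab x y by (simp add: inner_add_left)
  qed
  moreover have "convex_body S"
    using cS 0 unfolding S_def convex_body_def by (auto intro!: convex_closure convex_convex_hull)
  ultimately show ?thesis using that 0 by blast
qed

text \<open>The definite description is resolved: a body containing 0 has nonnegative support
  function, which is recovered from its p-th power and in turn determines the body.\<close>

lemma Lp_sum_body:
  fixes L M :: "'d::euclidean_space set"
  assumes L: "convex_body L" "0 \<in> L" and M: "convex_body M" "0 \<in> M" and p: "1 \<le> p"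
  shows "convex_body (Lp_sum p L M)" "0 \<in> Lp_sum p L M"
    "support_fun (Lp_sum p L M) u = (support_fun L u powr p + support_fun M u powr p) powr (1 / p)"
proof -
  obtain S where S: "convex_body S" "0 \<in> S"
    "\<And>u. support_fun S u = (support_fun L u powr p + support_fun M u powr p) powr (1 / p)"
    using Lp_sum_exists[OF assms] by blast
  have "Lp_sum p L M = S"
    unfolding Lp_sum_def
  proof (rule the_equality)
    show "convex_body S \<and> 0 \<in> S \<and>
      (\<forall>u. support_fun S u powr p = support_fun L u powr p + support_fun M u powr p)"
      using S p by (auto simp: powr_powr)
  next
    fix S' assume S': "convex_body S' \<and> 0 \<in> S' \<and>
      (\<forall>u. support_fun S' u powr p = support_fun L u powr p + support_fun M u powr p)"
    have "(support_fun S' u powr p) powr (1 / p) = support_fun S' u" for u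
    proof -
      have "0 \<le> support_fun S' u" using S' by (intro support_fun_nonneg) (auto simp: convex_body_def)
      then show ?thesis using p by (simp add: powr_powr)
    qed
    then show "S' = S" using S S' by (intro convex_body_eqI) metis+
  qed
  then show "convex_body (Lp_sum p L M)" "0 \<in> Lp_sum p L M"
    "support_fun (Lp_sum p L M) u = (support_fun L u powr p + support_fun M u powr p) powr (1 / p)"
    using S by auto
qed

section \<open>Volume as an integral of the gauge\<close>

text \<open>For a body around the origin this is the boundary of the polar body.\<close>

definition dual_sphere :: "'d::euclidean_space set \<Rightarrow> 'd set" where
  "dual_sphere S = {u. support_fun S u = 1}"

text \<open>The Minkowski gauge, encoded as the support function of the polar body. In this form it
  is a maximum of linear functions over a compact set, to which a Danskin argument applies.\<close>

definition gauge_fun :: "'d::euclidean_space set \<Rightarrow> 'd \<Rightarrow> real" where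
  "gauge_fun S = support_fun (dual_sphere S)"

lemma nn_integral_lborel_scaleR:
  fixes f :: "'d::euclidean_space \<Rightarrow> ennreal"
  assumes [measurable]: "f \<in> borel_measurable borel" and c: "0 < c"
  shows "(\<integral>\<^sup>+x. f x \<partial>lborel) = ennreal (c ^ DIM('d)) * (\<integral>\<^sup>+x. f (c *\<^sub>R x) \<partial>lborel)"
proof -
  have "(\<integral>\<^sup>+x. f x \<partial>lborel) =
      (\<integral>\<^sup>+x. f x \<partial>density (distr lborel borel (\<lambda>x. 0 + c *\<^sub>R x)) (\<lambda>_. \<bar>c\<bar> ^ DIM('d)))"
    using lborel_affine[of c "0::'d"] c by simp
  also have "\<dots> = ennreal (c ^ DIM('d)) * (\<integral>\<^sup>+x. f (c *\<^sub>R x) \<partial>lborel)"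
    using c by (simp add: nn_integral_density nn_integral_distr nn_integral_cmult)
  finally show ?thesis .
qed

locale body_around_origin =
  fixes S :: "'d::euclidean_space set"
  assumes body: "convex_body S" and interior: "0 \<in> interior S"
begin

lemma compact_body: "compact S" and body_nonempty: "S \<noteq> {}" and origin_in_body: "0 \<in> S"
  using body interior interior_subset by (auto simp: convex_body_def)

lemma support_fun_lower_bound:
  obtains r where "0 < r" "\<And>u. r * norm u \<le> support_fun S u"
proof -
  obtain r where r: "0 < r" "cball 0 r \<subseteq> S"
    using interior mem_interior_cball by blast
  have "r * norm u \<le> support_fun S u" for u
  proof (cases "u = 0")
    case False
    have "(r / norm u) *\<^sub>R u \<in> S" using r False by (intro subsetD[OF r(2)]) auto
    from inner_le_support_fun[OF compact_body this, of u] False show ?thesis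
      by (simp add: dot_square_norm power2_eq_square)
  qed (use support_fun_nonneg[OF compact_body origin_in_body] in auto)
  with r that show ?thesis by blast
qed

lemma support_fun_pos: "u \<noteq> 0 \<Longrightarrow> 0 < support_fun S u"
  using support_fun_lower_bound by (metis less_le_trans mult_pos_pos zero_less_norm_iff)

lemma normalize_in_dual_sphere: "u \<noteq> 0 \<Longrightarrow> (1 / support_fun S u) *\<^sub>R u \<in> dual_sphere S"
  using support_fun_pos[of u]
  by (simp add: dual_sphere_def support_fun_scaleR compact_body body_nonempty)

lemma compact_dual_sphere: "compact (dual_sphere S)"
proof -
  obtain r where r: "0 < r" "\<And>u. r * norm u \<le> support_fun S u"
    using support_fun_lower_bound by blast
  have "norm u \<le> 1 / r" if "u \<in> dual_sphere S" for u
    using r(2)[of u] r(1) that by (simp add: dual_sphere_def field_simps)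
  then have "bounded (dual_sphere S)" by (auto simp: bounded_iff)
  moreover have "closed (dual_sphere S)"
    unfolding dual_sphere_def
    by (intro closed_Collect_eq continuous_on_support_fun compact_body body_nonempty continuous_intros)
  ultimately show ?thesis by (simp add: compact_eq_bounded_closed)
qed

lemma dual_sphere_nonempty: "dual_sphere S \<noteq> {}"
  using normalize_in_dual_sphere nonempty_Basis nonzero_Basis by blast

lemma gauge_fun_scaleR: "0 \<le> c \<Longrightarrow> gauge_fun S (c *\<^sub>R x) = c * gauge_fun S x"
  unfolding gauge_fun_def by (intro support_fun_scaleR compact_dual_sphere dual_sphere_nonempty)

lemma measurable_gauge_fun [measurable]: "gauge_fun S \<in> borel_measurable borel"
  unfolding gauge_fun_def by (intro measurable_support_fun compact_dual_sphere dual_sphere_nonempty)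

lemma inner_le_gauge_fun: "u \<in> dual_sphere S \<Longrightarrow> x \<bullet> u \<le> gauge_fun S x"
  unfolding gauge_fun_def using inner_le_support_fun[OF compact_dual_sphere, of u x]
  by (simp add: inner_commute)

lemma gauge_fun_nonneg: "0 \<le> gauge_fun S x"
proof (cases "x = 0")
  case True
  then show ?thesis using gauge_fun_scaleR[of 0 0] by simp
next
  case False
  have "0 \<le> x \<bullet> ((1 / support_fun S x) *\<^sub>R x)" using support_fun_pos[OF False] by simp
  also have "\<dots> \<le> gauge_fun S x" by (intro inner_le_gauge_fun normalize_in_dual_sphere False)
  finally show ?thesis .
qed

text \<open>Bipolar theorem. Homogeneity reduces it to s = 1, where the bound on the gauge is the
  family of inequalities \<open>x \<bullet> u \<le> support_fun S u\<close>, rescaled so that the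
  right-hand side is 1.\<close>

lemma gauge_fun_le_iff: "0 < s \<Longrightarrow> gauge_fun S x \<le> s \<longleftrightarrow> x \<in> (\<lambda>y. s *\<^sub>R y) ` S"
proof -
  have *: "gauge_fun S x \<le> 1 \<longleftrightarrow> x \<in> S" for x
  proof
    assume x: "gauge_fun S x \<le> 1"
    have "x \<bullet> u \<le> support_fun S u" for u
    proof (cases "u = 0")
      case False
      have "x \<bullet> ((1 / support_fun S u) *\<^sub>R u) \<le> 1"
        using inner_le_gauge_fun[OF normalize_in_dual_sphere[OF False]] x by (rule order_trans)
      then show ?thesis using support_fun_pos[OF False] by (simp add: field_simps)
    qed (use support_fun_nonneg[OF compact_body origin_in_body] in auto)
    then show "x \<in> S" using mem_iff_inner_le_support_fun[OF body] by blast
  next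
    assume "x \<in> S"
    then show "gauge_fun S x \<le> 1"
      unfolding gauge_fun_def using inner_le_support_fun[OF compact_body \<open>x \<in> S\<close>]
      by (intro support_fun_least dual_sphere_nonempty) (metis dual_sphere_def inner_commute mem_Collect_eq)
  qed
  assume s: "0 < s"
  have "gauge_fun S x \<le> s \<longleftrightarrow> gauge_fun S ((1 / s) *\<^sub>R x) \<le> 1"
    using s by (simp add: gauge_fun_scaleR field_simps)
  also have "\<dots> \<longleftrightarrow> x \<in> (\<lambda>y. s *\<^sub>R y) ` S"
    unfolding * using s by (auto simp: image_iff intro!: bexI[of _ "x /\<^sub>R s"] simp: divide_inverse_commute)
  finally show ?thesis .
qed

text \<open>Layer cake: exp (- g) is the integral of exp (- s) over s at least g, the sublevel set
  at s is the dilate s S of volume s^d V(S), and the integral of s^d exp (- s) is d!.\<close>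

lemma nn_integral_exp_gauge_fun:
  "(\<integral>\<^sup>+x. ennreal (exp (- gauge_fun S x)) \<partial>lborel) = ennreal (fact DIM('d)) * emeasure lborel S"
proof -
  let ?g = "gauge_fun S"
  have S: "S \<in> sets lborel" using compact_body by (simp add: borel_compact)
  have tail: "ennreal (exp (- ?g x)) = (\<integral>\<^sup>+s. ennreal (exp (- s)) * indicator {?g x..} s \<partial>lborel)" for x
  proof -
    have "((\<lambda>s::real. - exp (- s)) \<longlongrightarrow> - 0) at_top"
      by (intro tendsto_minus filterlim_compose[OF exp_at_bot] filterlim_uminus_at_bot_at_top)
    then have "(\<integral>\<^sup>+s. ennreal (exp (- s)) * indicator {?g x..} s \<partial>lborel) = - 0 - - exp (- ?g x)"
      by (intro nn_integral_FTC_atLeast) (auto intro!: derivative_eq_intros)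
    then show ?thesis by simp
  qed
  have layer: "(\<integral>\<^sup>+x. indicator {?g x..} s \<partial>lborel) = ennreal (s ^ DIM('d)) * emeasure lborel S"
    if "0 < s" for s
  proof -
    have "(\<integral>\<^sup>+x. indicator {?g x..} s \<partial>lborel) = ennreal (s ^ DIM('d)) * (\<integral>\<^sup>+x. indicator {?g (s *\<^sub>R x)..} s \<partial>lborel)"
    proof (rule nn_integral_lborel_scaleR[OF _ that])
      have "(\<lambda>x. indicator {?g x..} s :: ennreal) = indicator {x. ?g x \<le> s}"
        by (auto simp: fun_eq_iff indicator_def)
      then show "(\<lambda>x. indicator {?g x..} s :: ennreal) \<in> borel_measurable borel" by simp
    qed
    also have "(\<integral>\<^sup>+x. indicator {?g (s *\<^sub>R x)..} s \<partial>lborel) = (\<integral>\<^sup>+x. indicator S x \<partial>lborel)"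
      using that gauge_fun_le_iff[OF that] by (intro nn_integral_cong) (auto simp: indicator_def)
    finally show ?thesis using S by simp
  qed
  have meas: "(\<lambda>(x, s). ennreal (exp (- s)) * indicator {?g x..} s) \<in> borel_measurable (lborel \<Otimes>\<^sub>M lborel)"
  proof -
    have "(\<lambda>(x, s). ennreal (exp (- s)) * indicator {?g x..} s) =
        (\<lambda>z. ennreal (exp (- snd z)) * indicator {z. ?g (fst z) \<le> snd z} z)"
      by (auto simp: fun_eq_iff indicator_def)
    then show ?thesis by simp
  qed
  have "(\<integral>\<^sup>+x. ennreal (exp (- ?g x)) \<partial>lborel) =
      (\<integral>\<^sup>+x. \<integral>\<^sup>+s. ennreal (exp (- s)) * indicator {?g x..} s \<partial>lborel \<partial>lborel)"
    by (simp add: tail)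
  also have "\<dots> = (\<integral>\<^sup>+s. \<integral>\<^sup>+x. ennreal (exp (- s)) * indicator {?g x..} s \<partial>lborel \<partial>lborel)"
    by (rule lborel_pair.Fubini'[OF meas, symmetric])
  also have "\<dots> = (\<integral>\<^sup>+s. ennreal (s ^ DIM('d) * exp (- s)) * indicator {0..} s * emeasure lborel S \<partial>lborel)"
  \<comment> \<open>The single level s = 0 is dropped because \<open>layer\<close> needs s > 0; for
    s < 0 both sides vanish since the gauge is nonnegative.\<close>
  proof (rule nn_integral_cong_AE)
    show "AE s in lborel. (\<integral>\<^sup>+x. ennreal (exp (- s)) * indicator {?g x..} s \<partial>lborel) =
        ennreal (s ^ DIM('d) * exp (- s)) * indicator {0..} s * emeasure lborel S"
      using AE_lborel_singleton[of "0::real"]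
    proof eventually_elim
      case (elim s)
      have m: "(\<lambda>x. indicator {?g x..} s :: ennreal) \<in> borel_measurable lborel"
      proof -
        have "(\<lambda>x. indicator {?g x..} s :: ennreal) = indicator {x. ?g x \<le> s}"
          by (auto simp: fun_eq_iff indicator_def)
        then show ?thesis by simp
      qed
      show ?case
      proof (cases "0 < s")
        case True
        then show ?thesis
          by (simp add: nn_integral_cmult[OF m] layer ennreal_mult' mult_ac)
      next
        case False
        then have "s < 0" using elim by simp
        then have "indicator {?g x..} s = (0::ennreal)" for x
          using gauge_fun_nonneg[of x] by (auto simp: indicator_def)
        then show ?thesis using \<open>s < 0\<close> by simp
      qed
    qed
  qed
  also have "\<dots> = ennreal (fact DIM('d)) * emeasure lborel S"
    by (subst nn_integral_multc) (auto simp: nn_intergal_power_times_exp_Ici)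
  finally show ?thesis .
qed

lemma measure_eq_integral_exp_gauge_fun:
  "measure lebesgue S = (\<integral>x. exp (- gauge_fun S x) \<partial>lborel) / fact DIM('d)"
proof -
  have S: "S \<in> sets lborel" using compact_body by (simp add: borel_compact)
  have "(\<integral>x. exp (- gauge_fun S x) \<partial>lborel) = enn2real (ennreal (fact DIM('d)) * emeasure lborel S)"
    unfolding nn_integral_exp_gauge_fun[symmetric] by (intro integral_eq_nn_integral) auto
  also have "\<dots> = fact DIM('d) * measure lborel S"
    by (simp add: enn2real_mult measure_def)
  also have "measure lborel S = measure lebesgue S" using S by simp
  finally show ?thesis by simp
qed

text \<open>Substituting c x for x reduces this to c = 1. The slower decay rates c < 1 are wanted
  for dominating functions.\<close>

lemma integrable_exp_gauge_fun:
  assumes "0 < c"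
  shows "integrable lborel (\<lambda>x. exp (- (c * gauge_fun S x)))"
proof (rule integrableI_nonneg)
  have "(\<integral>\<^sup>+x. ennreal (exp (- gauge_fun S x)) \<partial>lborel) =
      ennreal (c ^ DIM('d)) * (\<integral>\<^sup>+x. ennreal (exp (- gauge_fun S (c *\<^sub>R x))) \<partial>lborel)"
    by (rule nn_integral_lborel_scaleR) (use assms in auto)
  then have "ennreal (c ^ DIM('d)) * (\<integral>\<^sup>+x. ennreal (exp (- (c * gauge_fun S x))) \<partial>lborel) =
      ennreal (fact DIM('d)) * emeasure lborel S"
    using nn_integral_exp_gauge_fun assms by (simp add: gauge_fun_scaleR)
  also have "\<dots> \<noteq> \<top>"
    using emeasure_compact_finite[OF compact_body] by (auto simp: ennreal_mult_eq_top_iff)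
  finally show "(\<integral>\<^sup>+x. ennreal (exp (- (c * gauge_fun S x))) \<partial>lborel) < \<infinity>"
    using assms by (auto simp: ennreal_mult_eq_top_iff top.not_eq_extremum)
qed auto

end

section \<open>Almost everywhere uniqueness of the maximiser\<close>

context body_around_origin
begin

definition difference_quotient :: "nat \<Rightarrow> 'd \<Rightarrow> 'd \<Rightarrow> real" where
  "difference_quotient n e x = real (Suc n) * (gauge_fun S (x + (1 / real (Suc n)) *\<^sub>R e) - gauge_fun S x)"

text \<open>By convexity each infimum is the one-sided derivative of the gauge along e, so this is
  the gradient wherever the gauge is differentiable: the outer normal at the boundary point on the
  ray of x, normalised by h(S, u) = 1. A countable infimum gives a Borel map defined everywhere,
  with no measurable selection.\<close>

definition outer_normal :: "'d \<Rightarrow> 'd" where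
  "outer_normal x = (\<Sum>e\<in>Basis. (INF n. difference_quotient n e x) *\<^sub>R e)"

lemma measurable_difference_quotient [measurable]: "difference_quotient n e \<in> borel_measurable borel"
  unfolding difference_quotient_def[abs_def] by measurable

lemma measurable_outer_normal [measurable]: "outer_normal \<in> borel_measurable borel"
  unfolding outer_normal_def[abs_def] by measurable

lemma gauge_fun_attained:
  obtains u where "u \<in> dual_sphere S" "x \<bullet> u = gauge_fun S x"
  using support_fun_attained[OF compact_dual_sphere dual_sphere_nonempty, of x]
  by (metis gauge_fun_def inner_commute)

text \<open>A maximiser u is a subgradient of the gauge at x; the subgradient inequality is used
  with the steps 1/(n+1) and -1/(n+1) along e.\<close>

lemma maximiser_le_difference_quotient:
  assumes u: "u \<in> dual_sphere S" "x \<bullet> u = gauge_fun S x"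
  shows "u \<bullet> e \<le> difference_quotient n e x"
    and "difference_quotient n e (x - (1 / real (Suc n)) *\<^sub>R e) \<le> u \<bullet> e"
proof -
  have "gauge_fun S x + c * (u \<bullet> e) \<le> gauge_fun S (x + c *\<^sub>R e)" for c
    using inner_le_gauge_fun[OF u(1), of "x + c *\<^sub>R e"] u(2) by (simp add: inner_add_left inner_commute[of e u])
  from this[of "1 / real (Suc n)"] this[of "- (1 / real (Suc n))"]
  show "u \<bullet> e \<le> difference_quotient n e x"
    "difference_quotient n e (x - (1 / real (Suc n)) *\<^sub>R e) \<le> u \<bullet> e"
    by (simp_all add: difference_quotient_def field_simps)
qed

text \<open>Forward and backward difference quotients bound the \<open>e\<close>-component of every maximiser, and
  the backward one is a translate of the forward one. So the integral of their difference against
  the weight \<open>exp (- gauge_fun S x)\<close> tends to \<open>0\<close>; almost-everywhere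
  differentiability of convex functions is not needed.\<close>

lemma AE_INF_difference_quotient_gap:
  assumes e: "e \<in> Basis"
  shows "AE x in lborel. (INF n. difference_quotient n e x -
    difference_quotient n e (x - (1 / real (Suc n)) *\<^sub>R e)) \<le> 0"
proof -
  let ?g = "gauge_fun S"
  let ?h = "\<lambda>n. (1 / real (Suc n)) *\<^sub>R e"
  let ?q = "\<lambda>n. difference_quotient n e"
  let ?D = "\<lambda>n x. ?q n x - ?q n (x - ?h n)"
  define I where "I = (\<lambda>x. INF n. ?D n x)"
  define \<phi> where "\<phi> = (\<lambda>x. exp (- ?g x))"
  obtain R where R: "\<And>u. u \<in> dual_sphere S \<Longrightarrow> norm u \<le> R" "0 < R"
    using compact_imp_bounded[OF compact_dual_sphere] by (meson bounded_pos)
  have lip: "\<bar>?g x - ?g y\<bar> \<le> R * norm (x - y)" for x y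
    unfolding gauge_fun_def
    by (intro support_fun_lipschitz compact_dual_sphere dual_sphere_nonempty R)
  have nh: "norm (?h n) = 1 / real (Suc n)" for n using e by simp
  have q_le: "\<bar>?q n x\<bar> \<le> R" for n x
  proof -
    have "\<bar>?q n x\<bar> \<le> real (Suc n) * (R * (1 / real (Suc n)))"
      using lip[of "x + ?h n" x] nh[of n] unfolding difference_quotient_def abs_mult
      by (intro mult_mono) auto
    then show ?thesis by simp
  qed
  \<comment> \<open>Any maximiser at x lies between the backward and the forward quotient.\<close>
  have D_nonneg: "0 \<le> ?D n x" for n x
    using gauge_fun_attained[of x] maximiser_le_difference_quotient[of _ x, where e=e and n=n] by (smt (verit))
  have I: "0 \<le> I x" "I x \<le> ?D n x" for x n
    unfolding I_def using D_nonneg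
    by (auto intro!: cINF_greatest cINF_lower bdd_belowI2[of _ 0])
  have [measurable]: "\<phi> \<in> borel_measurable borel" "I \<in> borel_measurable borel"
    unfolding \<phi>_def I_def by measurable
  have int\<phi>: "integrable lborel \<phi>"
    using integrable_exp_gauge_fun[of 1] by (simp add: \<phi>_def)
  have bound: "\<bar>f x\<bar> \<le> C \<Longrightarrow> norm (\<phi> x * f x) \<le> C * \<phi> x" for f :: "'d \<Rightarrow> real" and x C
    by (simp add: \<phi>_def abs_mult mult_right_mono)
  have int: "integrable lborel (\<lambda>x. \<phi> x * f x)"
    if "f \<in> borel_measurable borel" "\<And>x. \<bar>f x\<bar> \<le> C" for f C
    by (rule Bochner_Integration.integrable_bound[where f="\<lambda>x. C * \<phi> x"])
      (use that bound int\<phi> in \<open>auto simp: \<phi>_def abs_mult intro!: order_trans[OF _ abs_ge_self] mult_right_mono\<close>)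
  have intI: "integrable lborel (\<lambda>x. \<phi> x * I x)"
  proof (rule int[where C = "2 * R"])
    show "\<bar>I x\<bar> \<le> 2 * R" for x
      using I(1)[of x] I(2)[of x 0] q_le[of 0 x] q_le[of 0 "x - ?h 0"] by linarith
  qed simp
  have "(\<integral>x. \<phi> x * I x \<partial>lborel) \<le> (exp (R / real (Suc n)) - 1) * R * (\<integral>x. \<phi> x \<partial>lborel)" for n
  proof -
    \<comment> \<open>Translation invariance moves the shift from the quotient to the weight. The
      integrated gap then becomes the bounded quotient times
      \<open>\<phi> x - \<phi> (x + ?h n)\<close>, which is small because the gauge is
      Lipschitz.\<close>
    have shift: "integrable lborel (\<lambda>x. \<phi> (x + ?h n) * ?q n x)"
        "(\<integral>x. \<phi> x * ?q n (x - ?h n) \<partial>lborel) = (\<integral>x. \<phi> (x + ?h n) * ?q n x \<partial>lborel)"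
    proof -
      have i: "integrable lborel (\<lambda>x. \<phi> x * ?q n (x - ?h n))"
        by (rule int[where C=R]) (use q_le in auto)
      then have i': "integrable (distr lborel borel ((+) (?h n))) (\<lambda>x. \<phi> x * ?q n (x - ?h n))"
        by (simp add: lborel_distr_plus)
      from i' show "integrable lborel (\<lambda>x. \<phi> (x + ?h n) * ?q n x)"
        by (subst (asm) integrable_distr_eq) (auto simp: add.commute)
      have "(\<integral>x. \<phi> x * ?q n (x - ?h n) \<partial>lborel) =
          (\<integral>x. \<phi> x * ?q n (x - ?h n) \<partial>distr lborel borel ((+) (?h n)))"
        by (simp add: lborel_distr_plus)
      also have "\<dots> = (\<integral>x. \<phi> (x + ?h n) * ?q n x \<partial>lborel)"
        by (subst integral_distr) (auto simp: add.commute)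
      finally show "(\<integral>x. \<phi> x * ?q n (x - ?h n) \<partial>lborel) = (\<integral>x. \<phi> (x + ?h n) * ?q n x \<partial>lborel)" .
    qed
    have i1: "integrable lborel (\<lambda>x. \<phi> x * ?q n x)" by (rule int[where C=R]) (use q_le in auto)
    have i2: "integrable lborel (\<lambda>x. \<phi> x * ?q n (x - ?h n))" by (rule int[where C=R]) (use q_le in auto)
    have "(\<integral>x. \<phi> x * I x \<partial>lborel) \<le> (\<integral>x. \<phi> x * ?D n x \<partial>lborel)"
    proof (rule integral_mono[OF intI])
      show "integrable lborel (\<lambda>x. \<phi> x * ?D n x)"
        using i1 i2 by (simp add: right_diff_distrib)
      show "\<phi> x * I x \<le> \<phi> x * ?D n x" for x
        using I(2)[of x n] by (intro mult_left_mono) (auto simp: \<phi>_def)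
    qed
    also have "\<dots> = (\<integral>x. \<phi> x * ?q n x \<partial>lborel) - (\<integral>x. \<phi> x * ?q n (x - ?h n) \<partial>lborel)"
      using i1 i2 by (simp add: right_diff_distrib)
    also have "\<dots> = (\<integral>x. (\<phi> x - \<phi> (x + ?h n)) * ?q n x \<partial>lborel)"
      using i1 shift by (simp add: left_diff_distrib)
    also have "\<dots> \<le> (\<integral>x. ((exp (R / real (Suc n)) - 1) * R) * \<phi> x \<partial>lborel)"
    proof (rule integral_mono)
      show "integrable lborel (\<lambda>x. (\<phi> x - \<phi> (x + ?h n)) * ?q n x)"
        using i1 shift by (simp add: left_diff_distrib)
      show "integrable lborel (\<lambda>x. ((exp (R / real (Suc n)) - 1) * R) * \<phi> x)" using int\<phi> by simp
      fix x
      define y where "y = ?g x - ?g (x + ?h n)"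
      have y: "\<bar>y\<bar> \<le> R / real (Suc n)"
        using lip[of x "x + ?h n"] nh[of n] by (simp add: y_def)
      have "\<bar>1 - exp y\<bar> \<le> exp (R / real (Suc n)) - 1"
      proof (cases "0 \<le> y")
        case True
        then show ?thesis using y by simp
      next
        case False
        \<comment> \<open>For negative y: 1 - exp y is at most -y, which is at most exp (-y) -
          1.\<close>
        have "1 + y \<le> exp y" "1 + (- y) \<le> exp (- y)" by (rule exp_ge_add_one_self)+
        moreover have "exp (- y) \<le> exp (R / real (Suc n))" using y by simp
        moreover have "exp y \<le> 1" using False by simp
        ultimately show ?thesis by linarith
      qed
      moreover have "\<phi> x - \<phi> (x + ?h n) = \<phi> x * (1 - exp y)"
        by (simp add: \<phi>_def y_def right_diff_distrib exp_add[symmetric] exp_diff exp_minus field_simps)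
      ultimately have "\<bar>\<phi> x - \<phi> (x + ?h n)\<bar> \<le> \<phi> x * (exp (R / real (Suc n)) - 1)"
        by (simp add: abs_mult \<phi>_def)
      then have "\<bar>\<phi> x - \<phi> (x + ?h n)\<bar> * \<bar>?q n x\<bar> \<le> (\<phi> x * (exp (R / real (Suc n)) - 1)) * R"
        using q_le[of n x] R(2) by (intro mult_mono) (auto simp: \<phi>_def)
      then have "\<bar>(\<phi> x - \<phi> (x + ?h n)) * ?q n x\<bar> \<le> (exp (R / real (Suc n)) - 1) * R * \<phi> x"
        by (simp add: abs_mult mult_ac)
      then show "(\<phi> x - \<phi> (x + ?h n)) * ?q n x \<le> (exp (R / real (Suc n)) - 1) * R * \<phi> x"
        by linarith
    qed
    finally show ?thesis by simp
  qed
  moreover have "(\<lambda>n. (exp (R / real (Suc n)) - 1) * R * (\<integral>x. \<phi> x \<partial>lborel)) \<longlonglongrightarrow>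
      (exp 0 - 1) * R * (\<integral>x. \<phi> x \<partial>lborel)"
    by (intro tendsto_intros tendsto_divide_0[OF tendsto_const] filterlim_compose[OF tendsto_exp]
        filterlim_at_top_imp_at_infinity filterlim_compose[OF filterlim_real_sequentially filterlim_Suc])
  ultimately have "(\<integral>x. \<phi> x * I x \<partial>lborel) \<le> 0"
    by (intro LIMSEQ_le_const) auto
  moreover have nn: "0 \<le> \<phi> x * I x" for x using I(1)[of x] by (simp add: \<phi>_def)
  ultimately have "(\<integral>x. \<phi> x * I x \<partial>lborel) = 0"
    by (intro antisym integral_nonneg_AE) auto
  then have "AE x in lborel. \<phi> x * I x = 0"
    using nn intI by (subst (asm) integral_nonneg_eq_0_iff_AE) auto
  then have "AE x in lborel. I x \<le> 0"
    by eventually_elim (simp add: \<phi>_def)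
  then show ?thesis by (simp add: I_def)
qed

text \<open>For a maximiser u the number (INF of the forward quotients) - u . e is nonnegative and
  bounded by the infimum of the gaps, which is almost everywhere at most 0. So every coordinate of u
  is forced.\<close>

lemma AE_unique_maximiser:
  "AE x in lborel. \<forall>u\<in>dual_sphere S. x \<bullet> u = gauge_fun S x \<longrightarrow> u = outer_normal x"
proof -
  have "AE x in lborel. \<forall>e\<in>Basis. (INF n. difference_quotient n e x -
      difference_quotient n e (x - (1 / real (Suc n)) *\<^sub>R e)) \<le> 0"
    by (intro AE_ball_countable[THEN iffD2] ballI AE_INF_difference_quotient_gap countable_finite finite_Basis)
  then show ?thesis
  proof (eventually_elim, intro ballI impI)
    fix x u
    assume gap: "\<forall>e\<in>Basis. (INF n. difference_quotient n e x -
      difference_quotient n e (x - (1 / real (Suc n)) *\<^sub>R e)) \<le> 0"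
      and u: "u \<in> dual_sphere S" "x \<bullet> u = gauge_fun S x"
    have "(INF n. difference_quotient n e x) = u \<bullet> e" if "e \<in> Basis" for e
    proof (rule antisym)
      note le = maximiser_le_difference_quotient[OF u, where e=e]
      have "(INF n. difference_quotient n e x) - u \<bullet> e \<le> (INF n. difference_quotient n e x -
          difference_quotient n e (x - (1 / real (Suc n)) *\<^sub>R e))"
      proof (rule cINF_greatest)
        fix n
        have "(INF n. difference_quotient n e x) \<le> difference_quotient n e x"
          using le(1) by (intro cINF_lower bdd_belowI2) auto
        then show "(INF n. difference_quotient n e x) - u \<bullet> e \<le> difference_quotient n e x -
            difference_quotient n e (x - (1 / real (Suc n)) *\<^sub>R e)"
          using le(2)[of n] by linarith
      qed simp
      then show "(INF n. difference_quotient n e x) \<le> u \<bullet> e" using gap that by force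
      show "u \<bullet> e \<le> (INF n. difference_quotient n e x)"
        using le(1) by (intro cINF_greatest) auto
    qed
    then show "u = outer_normal x"
      unfolding outer_normal_def by (simp add: euclidean_representation)
  qed
qed

end

section \<open>The mixed volume as an integral of the support function\<close>

text \<open>Mean value theorem with a decreasing derivative. The two bounds agree to first order at
  0 and later squeeze a difference quotient in t.\<close>

lemma powr_neg_inverse_bounds:
  fixes s p :: real
  assumes "0 \<le> s" "1 \<le> p"
  shows "1 - (1 + s) powr (- (1 / p)) \<le> s / p"
    and "s / p * (1 + s) powr (- (1 / p) - 1) \<le> 1 - (1 + s) powr (- (1 / p))"
proof -
  let ?f = "\<lambda>x. - ((1 + x) powr (- (1 / p)))"
  let ?f' = "\<lambda>x. 1 / p * (1 + x) powr (- (1 / p) - 1)"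
  have "\<exists>z. 0 \<le> z \<and> z \<le> s \<and> ?f s - ?f 0 = s * ?f' z"
  proof (cases "s = 0")
    case False
    then have "\<exists>z>0. z < s \<and> ?f s - ?f 0 = (s - 0) * ?f' z"
      using assms by (intro MVT2) (auto intro!: derivative_eq_intros)
    then show ?thesis by (metis diff_zero less_imp_le)
  qed auto
  then obtain z where z: "0 \<le> z" "z \<le> s" "?f s - ?f 0 = s * ?f' z" by blast
  have "0 \<le> 1 / p" using assms by simp
  then have p': "- (1 / p) - 1 \<le> 0" by linarith
  have "(1 + z) powr (- (1 / p) - 1) \<le> (1 + 0) powr (- (1 / p) - 1)"
    using z p' by (intro powr_mono2') auto
  then have "s / p * (1 + z) powr (- (1 / p) - 1) \<le> s / p * 1"
    using assms by (intro mult_left_mono) auto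
  then show "1 - (1 + s) powr (- (1 / p)) \<le> s / p"
    using z(3) by simp
  have "(1 + s) powr (- (1 / p) - 1) \<le> (1 + z) powr (- (1 / p) - 1)"
    using z p' by (intro powr_mono2') auto
  then have "s / p * (1 + s) powr (- (1 / p) - 1) \<le> s / p * (1 + z) powr (- (1 / p) - 1)"
    using assms by (intro mult_left_mono) auto
  then show "s / p * (1 + s) powr (- (1 / p) - 1) \<le> 1 - (1 + s) powr (- (1 / p))"
    using z(3) by simp
qed

text \<open>Stability of the argmax: outside a ball about \<open>u\<^sub>0\<close> compactness keeps
  f below some c < \<open>f u\<^sub>0\<close>, so points with almost maximal value must enter the
  ball.\<close>

lemma tendsto_unique_maximiser:
  fixes f :: "'d::metric_space \<Rightarrow> real"
  assumes B: "compact B" "continuous_on B f" "u\<^sub>0 \<in> B"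
    and unique: "\<And>u. u \<in> B \<Longrightarrow> u \<noteq> u\<^sub>0 \<Longrightarrow> f u < f u\<^sub>0"
    and U: "eventually (\<lambda>t. U t \<in> B) F" "((\<lambda>t. f (U t)) \<longlongrightarrow> f u\<^sub>0) F"
  shows "(U \<longlongrightarrow> u\<^sub>0) F"
proof (rule tendstoI)
  fix e :: real assume e: "0 < e"
  have "\<exists>c<f u\<^sub>0. \<forall>u\<in>B - ball u\<^sub>0 e. f u \<le> c"
  proof (cases "B - ball u\<^sub>0 e = {}")
    case True
    then show ?thesis by (metis empty_iff lt_ex)
  next
    case False
    have "compact (B - ball u\<^sub>0 e)" using B by (intro compact_diff) auto
    from continuous_attains_sup[OF this False continuous_on_subset[OF B(2)]]
    obtain v where "v \<in> B - ball u\<^sub>0 e" "\<forall>u\<in>B - ball u\<^sub>0 e. f u \<le> f v" by auto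
    moreover from this have "v \<noteq> u\<^sub>0" using e by auto
    ultimately show ?thesis using unique[of v] by (intro exI[of _ "f v"]) auto
  qed
  then obtain c where c: "c < f u\<^sub>0" "\<And>u. u \<in> B - ball u\<^sub>0 e \<Longrightarrow> f u \<le> c" by auto
  have "eventually (\<lambda>t. c < f (U t)) F" using U(2) c(1) by (rule order_tendstoD)
  with U(1) show "eventually (\<lambda>t. dist (U t) u\<^sub>0 < e) F"
  proof eventually_elim
    case (elim t)
    then show ?case using c(2)[of "U t"] by (auto simp: dist_commute)
  qed
qed

lemma exp_minus_one_bounds:
  fixes y :: real
  shows "y \<le> exp y - 1" "exp y - 1 \<le> y * exp y"
proof -
  show "y \<le> exp y - 1" using exp_ge_add_one_self[of y] by linarith
  have "(1 - y) * exp y \<le> exp (- y) * exp y"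
    using exp_ge_add_one_self[of "- y"] by (intro mult_right_mono) auto
  then show "exp y - 1 \<le> y * exp y" by (simp add: algebra_simps exp_minus)
qed

context body_around_origin
begin

text \<open>The mass of a set A is the volume of the part of S where \<open>outer_normal\<close>
  lies in A: integrating along rays, the integral of s^d exp (- s) is d!, and the radial Jacobian
  contributes d. This is the cone-volume measure, with total mass the volume of S.\<close>

definition surface_measure :: "'d measure" where
  "surface_measure = distr (density lborel
     (\<lambda>x. ennreal (exp (- gauge_fun S x) * gauge_fun S x / (DIM('d) * fact DIM('d))))) borel outer_normal"

text \<open>Half of the exponential decay absorbs the linear factor, by y \<le> exp y with y = c g /
  2.\<close>

lemma gauge_times_exp_le:
  assumes "0 < c"
  shows "exp (- (c * gauge_fun S x)) * gauge_fun S x \<le> 2 / c * exp (- (c / 2 * gauge_fun S x))"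
proof -
  define y where "y = c / 2 * gauge_fun S x"
  have "y \<le> exp y" using exp_ge_add_one_self[of y] by linarith
  then have "exp (- (2 * y)) * y \<le> exp (- (2 * y)) * exp y" by (intro mult_left_mono) auto
  also have "\<dots> = exp (- y)" by (simp add: exp_add[symmetric])
  finally have "2 / c * (exp (- (2 * y)) * y) \<le> 2 / c * exp (- y)"
    using assms by (intro mult_left_mono) auto
  moreover have "2 / c * (exp (- (2 * y)) * y) = exp (- (c * gauge_fun S x)) * gauge_fun S x"
    using assms by (simp add: y_def)
  ultimately show ?thesis by (simp add: y_def)
qed

lemma integrable_gauge_times_exp:
  assumes "0 < c"
  shows "integrable lborel (\<lambda>x. exp (- (c * gauge_fun S x)) * gauge_fun S x)"
  by (rule Bochner_Integration.integrable_bound[where f="\<lambda>x. 2 / c * exp (- (c / 2 * gauge_fun S x))"])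
    (use integrable_exp_gauge_fun[of "c / 2"] assms gauge_times_exp_le[OF assms] gauge_fun_nonneg
      in \<open>auto simp: abs_mult intro!: order_trans[OF _ abs_ge_self]\<close>)

lemma finite_measure_surface_measure: "finite_measure surface_measure"
  unfolding surface_measure_def
proof (intro finite_measure.finite_measure_distr finite_measureI)
  have "integrable lborel (\<lambda>x. exp (- gauge_fun S x) * gauge_fun S x / (DIM('d) * fact DIM('d)))"
    using integrable_gauge_times_exp[of 1] by simp
  then have "(\<integral>\<^sup>+x. ennreal (exp (- gauge_fun S x) * gauge_fun S x / (DIM('d) * fact DIM('d))) \<partial>lborel) < \<infinity>"
    using gauge_fun_nonneg by (subst nn_integral_eq_integral) auto
  then show "emeasure (density lborel (\<lambda>x. ennreal (exp (- gauge_fun S x) * gauge_fun S x / (DIM('d) * fact DIM('d)))))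
      (space (density lborel (\<lambda>x. ennreal (exp (- gauge_fun S x) * gauge_fun S x / (DIM('d) * fact DIM('d)))))) \<noteq> \<infinity>"
    by (simp add: emeasure_density top.not_eq_extremum)
qed simp

lemma sets_surface_measure [measurable_cong]: "sets surface_measure = sets borel"
  by (simp add: surface_measure_def)

lemma body_around_origin_Lp_sum:
  assumes "convex_body M" "0 \<in> M" "1 \<le> p"
  shows "body_around_origin (Lp_sum p S M)"
proof
  note * = Lp_sum_body[OF body origin_in_body assms]
  show "convex_body (Lp_sum p S M)" by (rule *(1))
  have M: "compact M" using assms by (simp add: convex_body_def)
  have "x \<bullet> u \<le> support_fun (Lp_sum p S M) u" if "x \<in> S" for x u
  proof -
    have h: "0 \<le> support_fun S u" using support_fun_nonneg[OF compact_body origin_in_body] .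
    have "x \<bullet> u \<le> support_fun S u" using inner_le_support_fun[OF compact_body that] .
    also have "\<dots> = (support_fun S u powr p) powr (1 / p)" using assms h by (simp add: powr_powr)
    also have "\<dots> \<le> support_fun (Lp_sum p S M) u"
      unfolding * using assms by (intro powr_mono2) auto
    finally show ?thesis .
  qed
  then have "S \<subseteq> Lp_sum p S M" using mem_iff_inner_le_support_fun[OF *(1)] by blast
  then show "0 \<in> interior (Lp_sum p S M)" using interior interior_mono by blast
qed

section \<open>First variation of the gauge and of the volume\<close>

context
  fixes M :: "'d set" and p :: real
  assumes M: "convex_body M" "0 \<in> M" and p: "1 \<le> p"
begin

definition perturbed :: "real \<Rightarrow> 'd set" where
  "perturbed t = Lp_sum p S ((\<lambda>x. (t powr (1 / p)) *\<^sub>R x) ` M)"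

definition weight :: "'d \<Rightarrow> real" where
  "weight u = support_fun M u powr p"

text \<open>On the dual sphere of S the perturbed support function is (1 + s)^(1/p) with s =
  \<open>t * weight u\<close>; its reciprocal is the factor that moves u to the dual sphere of the
  perturbed body.\<close>

definition shrink :: "real \<Rightarrow> real" where
  "shrink s = (1 + s) powr (- (1 / p))"

lemma weight_nonneg: "0 \<le> weight u"
  by (simp add: weight_def)

lemma continuous_on_weight: "continuous_on A weight"
proof -
  have "compact M" "M \<noteq> {}" using M by (auto simp: convex_body_def)
  then show ?thesis
    unfolding weight_def[abs_def] using p support_fun_nonneg[of M] M(2)
    by (intro continuous_on_powr' continuous_on_support_fun continuous_intros) auto
qed

lemma perturbing_body: "convex_body ((\<lambda>x. (t powr (1 / p)) *\<^sub>R x) ` M)" "0 \<in> (\<lambda>x. (t powr (1 / p)) *\<^sub>R x) ` M"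
  using M unfolding convex_body_def by (auto intro!: compact_scaling convex_scaling image_eqI[of _ _ 0])

lemma body_around_origin_perturbed: "body_around_origin (perturbed t)"
  unfolding perturbed_def by (intro body_around_origin_Lp_sum perturbing_body p)

lemma support_fun_perturbed:
  assumes "0 < t"
  shows "support_fun (perturbed t) u = (support_fun S u powr p + t * weight u) powr (1 / p)"
proof -
  have cM: "compact M" "M \<noteq> {}" using M by (auto simp: convex_body_def)
  have "support_fun ((\<lambda>x. (t powr (1 / p)) *\<^sub>R x) ` M) u powr p = t * weight u"
    using support_fun_nonneg[OF cM(1) M(2)] assms p
    by (simp add: support_fun_image_scaleR[OF cM] powr_mult powr_powr weight_def)
  then show ?thesis
    unfolding perturbed_def by (simp add: Lp_sum_body[OF body origin_in_body perturbing_body p])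
qed

lemma support_fun_perturbed_dual_sphere:
  assumes "0 < t" "u \<in> dual_sphere S"
  shows "support_fun (perturbed t) u = 1 / shrink (t * weight u)"
  using assms by (simp add: support_fun_perturbed dual_sphere_def shrink_def powr_minus_divide)

lemma shrink_bounds:
  assumes "0 \<le> s"
  shows "0 < shrink s" "shrink s \<le> 1" "1 - shrink s \<le> s / p"
    "s / p * (1 + s) powr (- (1 / p) - 1) \<le> 1 - shrink s" "s \<le> s' \<Longrightarrow> shrink s' \<le> shrink s"
proof -
  show "shrink s \<le> 1" using assms p powr_mono2'[of "- (1 / p)" 1 "1 + s"] by (simp add: shrink_def)
  show "s \<le> s' \<Longrightarrow> shrink s' \<le> shrink s"
    using assms p by (auto simp: shrink_def intro!: powr_mono2')
qed (use assms powr_neg_inverse_bounds[OF assms p] in \<open>auto simp: shrink_def\<close>)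

text \<open>The two dual spheres meet each ray from the origin once, so the perturbed gauge is a
  maximum over the fixed dual sphere of S. This is the upper bound on its members; attainment is
  proved separately.\<close>

lemma gauge_fun_perturbed_ge:
  assumes "0 < t" "u \<in> dual_sphere S"
  shows "x \<bullet> u * shrink (t * weight u) \<le> gauge_fun (perturbed t) x"
proof -
  interpret P: body_around_origin "perturbed t" by (rule body_around_origin_perturbed)
  have "0 \<le> t * weight u" using assms weight_nonneg by simp
  then have s: "0 < shrink (t * weight u)" by (rule shrink_bounds)
  then have "u \<noteq> 0" using assms support_fun_scaleR[OF compact_body body_nonempty, of 0 0]
    by (auto simp: dual_sphere_def)
  from P.inner_le_gauge_fun[OF P.normalize_in_dual_sphere[OF this], of x] s
  show ?thesis by (simp add: support_fun_perturbed_dual_sphere[OF assms] mult.commute)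
qed

text \<open>A maximiser v on the perturbed dual sphere is rescaled radially to u on that of S;
  comparing the normalisations identifies the scale as \<open>shrink (t * weight u)\<close>.\<close>

lemma gauge_fun_perturbed_attained:
  assumes t: "0 < t"
  obtains u where "u \<in> dual_sphere S" "gauge_fun (perturbed t) x = x \<bullet> u * shrink (t * weight u)"
proof -
  interpret P: body_around_origin "perturbed t" by (rule body_around_origin_perturbed)
  obtain v where v: "v \<in> dual_sphere (perturbed t)" "x \<bullet> v = gauge_fun (perturbed t) x"
    using P.gauge_fun_attained by blast
  have "v \<noteq> 0"
    using v support_fun_scaleR[OF P.compact_body P.body_nonempty, of 0 0] by (auto simp: dual_sphere_def)
  define c where "c = support_fun S v"
  have c: "0 < c" using support_fun_pos[OF \<open>v \<noteq> 0\<close>] by (simp add: c_def)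
  define u where "u = (1 / c) *\<^sub>R v"
  have u: "u \<in> dual_sphere S"
    unfolding u_def c_def by (intro normalize_in_dual_sphere \<open>v \<noteq> 0\<close>)
  have vu: "v = c *\<^sub>R u" using c by (simp add: u_def)
  have pos: "0 < shrink (t * weight u)" using t weight_nonneg by (intro shrink_bounds) simp
  have "1 = support_fun (perturbed t) v" using v by (simp add: dual_sphere_def)
  also have "\<dots> = c / shrink (t * weight u)"
    unfolding vu using support_fun_perturbed_dual_sphere[OF t u] c
    by (simp add: support_fun_scaleR[OF P.compact_body P.body_nonempty])
  finally have "c = shrink (t * weight u)" using pos by simp
  with v vu u that show ?thesis by (simp add: mult.commute)
qed

lemma gauge_fun_perturbed_le: "0 < t \<Longrightarrow> gauge_fun (perturbed t) x \<le> gauge_fun S x"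
proof -
  assume t: "0 < t"
  obtain u where u: "u \<in> dual_sphere S" "gauge_fun (perturbed t) x = x \<bullet> u * shrink (t * weight u)"
    using gauge_fun_perturbed_attained[OF t] by blast
  have s: "0 \<le> t * weight u" using t weight_nonneg by simp
  have "x \<bullet> u * shrink (t * weight u) \<le> gauge_fun S x * shrink (t * weight u)"
    using inner_le_gauge_fun[OF u(1)] shrink_bounds(1)[OF s] by (intro mult_right_mono) auto
  also have "\<dots> \<le> gauge_fun S x * 1"
    using shrink_bounds(2)[OF s] gauge_fun_nonneg by (intro mult_left_mono) auto
  finally show ?thesis using u by simp
qed

text \<open>Danskin's theorem. Testing the perturbed maximum with the old maximiser
  \<open>u0\<close> bounds the quotient above; testing the old maximum with the perturbed maximiser
  \<open>U t\<close> bounds it below. The bounds meet once \<open>U t\<close> tends to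
  \<open>u0\<close>.\<close>

lemma tendsto_gauge_fun_perturbed:
  assumes unique: "\<forall>u\<in>dual_sphere S. x \<bullet> u = gauge_fun S x \<longrightarrow> u = outer_normal x"
  shows "((\<lambda>t. (gauge_fun S x - gauge_fun (perturbed t) x) / t) \<longlongrightarrow>
    gauge_fun S x * weight (outer_normal x) / p) (at_right 0)"
proof -
  let ?g = "gauge_fun S x" and ?G = "\<lambda>t. gauge_fun (perturbed t) x"
  define u0 where "u0 = outer_normal x"
  have u0: "u0 \<in> dual_sphere S" "x \<bullet> u0 = ?g"
    using gauge_fun_attained[of x] unique unfolding u0_def by metis+
  have "\<exists>u. u \<in> dual_sphere S \<and> (0 < t \<longrightarrow> ?G t = x \<bullet> u * shrink (t * weight u))" for t
    using u0(1) by (metis gauge_fun_perturbed_attained)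
  then obtain U where U: "\<And>t. U t \<in> dual_sphere S"
      "\<And>t. 0 < t \<Longrightarrow> ?G t = x \<bullet> U t * shrink (t * weight (U t))"
    by metis
  have s: "0 \<le> t * weight u" if "0 < t" for t u using that weight_nonneg by simp
  have pos: "eventually (\<lambda>t::real. 0 < t) (at_right 0)" by (simp add: eventually_at_right_less)
  have id: "((\<lambda>t::real. t) \<longlongrightarrow> 0) (at_right 0)" by (rule tendsto_ident_at)
  \<comment> \<open>The perturbed maximum is nonnegative, hence so is
    \<open>x \<bullet> U t\<close>, and the factor \<open>shrink\<close>, being at most 1, may be
    dropped. This makes \<open>U t\<close> almost maximal for the unperturbed problem.\<close>
  have inner_lower: "?g * shrink (t * weight u0) \<le> x \<bullet> U t" if t: "0 < t" for t
  proof -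
    have "0 \<le> ?g * shrink (t * weight u0)"
      using gauge_fun_nonneg shrink_bounds(1)[OF s[OF t]] by (simp add: less_imp_le)
    also have *: "\<dots> \<le> x \<bullet> U t * shrink (t * weight (U t))"
      using gauge_fun_perturbed_ge[OF t u0(1), of x] U(2)[OF t] u0(2) by simp
    finally have "0 \<le> x \<bullet> U t"
      using shrink_bounds(1)[OF s[OF t], of "U t"] by (simp add: zero_le_mult_iff)
    then have "x \<bullet> U t * shrink (t * weight (U t)) \<le> x \<bullet> U t"
      using shrink_bounds(2)[OF s[OF t], of "U t"] by (simp add: mult_left_le)
    with * show ?thesis by simp
  qed
  have "((\<lambda>t. x \<bullet> U t) \<longlongrightarrow> ?g) (at_right 0)"
  proof (rule tendsto_sandwich)
    show "eventually (\<lambda>t. ?g * shrink (t * weight u0) \<le> x \<bullet> U t) (at_right 0)"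
      using pos by eventually_elim (rule inner_lower)
    show "eventually (\<lambda>t. x \<bullet> U t \<le> ?g) (at_right 0)"
      using U(1) inner_le_gauge_fun by simp
    have "((\<lambda>t. ?g * shrink (t * weight u0)) \<longlongrightarrow> ?g * (1 + 0 * weight u0) powr (- (1 / p))) (at_right 0)"
      unfolding shrink_def by (intro tendsto_intros id) simp_all
    then show "((\<lambda>t. ?g * shrink (t * weight u0)) \<longlongrightarrow> ?g) (at_right 0)" by simp
  qed auto
  then have "(U \<longlongrightarrow> u0) (at_right 0)"
  proof (intro tendsto_unique_maximiser[where f = "\<lambda>u. x \<bullet> u" and B = "dual_sphere S"])
    fix u assume u: "u \<in> dual_sphere S" "u \<noteq> u0"
    then show "x \<bullet> u < x \<bullet> u0"
      using unique inner_le_gauge_fun[OF u(1), of x] u0(2) u0_def by fastforce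
  qed (simp_all add: u0 U compact_dual_sphere continuous_on_inner)
  then have k: "((\<lambda>t. weight (U t)) \<longlongrightarrow> weight u0) (at_right 0)"
    by (rule continuous_on_tendsto_compose[OF continuous_on_weight[of UNIV]]) simp_all
  show ?thesis
    unfolding u0_def[symmetric]
  proof (rule tendsto_sandwich)
    show "eventually (\<lambda>t. ?g * (weight (U t) / p * (1 + t * weight (U t)) powr (- (1 / p) - 1)) \<le> (?g - ?G t) / t) (at_right 0)"
      using pos
    proof eventually_elim
      case (elim t)
      have "?G t \<le> ?g * shrink (t * weight (U t))"
        unfolding U(2)[OF elim] using inner_le_gauge_fun[OF U(1)] shrink_bounds(1)[OF s[OF elim]]
        by (intro mult_right_mono) (auto simp: less_imp_le)
      then have "?g * (1 - shrink (t * weight (U t))) \<le> ?g - ?G t" by (simp add: algebra_simps)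
      moreover have "?g * (t * weight (U t) / p * (1 + t * weight (U t)) powr (- (1 / p) - 1)) \<le>
          ?g * (1 - shrink (t * weight (U t)))"
        using shrink_bounds(4)[OF s[OF elim], of "U t"] gauge_fun_nonneg by (intro mult_left_mono) auto
      ultimately have "t * (?g * (weight (U t) / p * (1 + t * weight (U t)) powr (- (1 / p) - 1))) \<le> ?g - ?G t"
        by (simp add: mult_ac)
      then show ?case using elim by (simp add: pos_le_divide_eq mult.commute)
    qed
    show "eventually (\<lambda>t. (?g - ?G t) / t \<le> ?g * weight u0 / p) (at_right 0)"
      using pos
    proof eventually_elim
      case (elim t)
      have "?g * shrink (t * weight u0) \<le> ?G t"
        using gauge_fun_perturbed_ge[OF elim u0(1), of x] u0(2) by simp
      then have "?g - ?G t \<le> ?g * (1 - shrink (t * weight u0))" by (simp add: algebra_simps)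
      also have "\<dots> \<le> ?g * (t * weight u0 / p)"
        using shrink_bounds(3)[OF s[OF elim], of u0] gauge_fun_nonneg by (intro mult_left_mono) auto
      finally show ?case using elim by (simp add: pos_divide_le_eq mult_ac)
    qed
    have "((\<lambda>t. ?g * (weight (U t) / p * (1 + t * weight (U t)) powr (- (1 / p) - 1))) \<longlongrightarrow>
        ?g * (weight u0 / p * (1 + 0 * weight u0) powr (- (1 / p) - 1))) (at_right 0)"
      by (intro tendsto_intros id k) (use p in auto)
    then show "((\<lambda>t. ?g * (weight (U t) / p * (1 + t * weight (U t)) powr (- (1 / p) - 1))) \<longlongrightarrow>
        ?g * weight u0 / p) (at_right 0)" by simp
  qed simp
qed

lemma weight_bounded: obtains W where "0 < W" "\<And>u. u \<in> dual_sphere S \<Longrightarrow> weight u \<le> W"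
proof -
  have "bounded (weight ` dual_sphere S)"
    by (intro compact_imp_bounded compact_continuous_image continuous_on_weight compact_dual_sphere)
  then obtain W where "0 < W" "\<forall>y\<in>weight ` dual_sphere S. norm y \<le> W" unfolding bounded_pos by blast
  then show ?thesis by (intro that[of W]) auto
qed

lemma outer_normal_in_dual_sphere: "AE x in lborel. outer_normal x \<in> dual_sphere S"
  using AE_unique_maximiser by eventually_elim (metis gauge_fun_attained)

lemma measurable_weight [measurable]: "weight \<in> borel_measurable borel"
  by (intro borel_measurable_continuous_onI continuous_on_weight)

text \<open>Dominated convergence along sequences. With y = g - G the integrand is exp (- g) (exp y
  - 1) / t, and the bounds y \<le> exp y - 1 \<le> y exp y reduce its limit to that of y /
  t.\<close>

lemma tendsto_integral_perturbed:
  "((\<lambda>t. \<integral>x. (exp (- gauge_fun (perturbed t) x) - exp (- gauge_fun S x)) / t \<partial>lborel) \<longlongrightarrow>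
    (\<integral>x. exp (- gauge_fun S x) * (gauge_fun S x * weight (outer_normal x) / p) \<partial>lborel)) (at_right 0)"
proof -
  let ?G = "\<lambda>t. gauge_fun (perturbed t)" and ?g = "gauge_fun S"
  have G: "?G t \<in> borel_measurable borel" for t
  proof -
    interpret P: body_around_origin "perturbed t" by (rule body_around_origin_perturbed)
    show ?thesis by simp
  qed
  obtain W where W: "0 < W" "\<And>u. u \<in> dual_sphere S \<Longrightarrow> weight u \<le> W" using weight_bounded by blast
  \<comment> \<open>For t \<le> 1 the perturbed gauge is at least c g, since \<open>shrink\<close>
    decreases; and (g - G) / t is at most (W / p) g. These two estimates give the dominating
    function B.\<close>
  define c where "c = shrink W"
  have c: "0 < c" unfolding c_def using shrink_bounds[of W] W by simp
  define B where "B = (\<lambda>x. W / p * (exp (- (c * ?g x)) * ?g x))"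
  have intB: "integrable lborel B" unfolding B_def using integrable_gauge_times_exp[OF c] by simp
  have le: "norm ((exp (- ?G t x) - exp (- ?g x)) / t) \<le> B x" if t: "0 < t" "t \<le> 1" for t x
  proof -
    obtain u where u: "u \<in> dual_sphere S" "x \<bullet> u = ?g x" using gauge_fun_attained by blast
    have w: "0 \<le> weight u" "weight u \<le> W" using weight_nonneg W(2)[OF u(1)] by auto
    have tw: "0 \<le> t * weight u" "t * weight u \<le> t * W" "t * weight u \<le> W"
      using t w mult_mono[of t 1 "weight u" W] by auto
    have G1: "?g x * shrink (t * weight u) \<le> ?G t x"
      using gauge_fun_perturbed_ge[OF t(1) u(1), of x] u(2) by simp
    have le: "?G t x \<le> ?g x" by (rule gauge_fun_perturbed_le[OF t(1)])
    have "?g x * c \<le> ?g x * shrink (t * weight u)"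
      unfolding c_def using shrink_bounds(5)[OF tw(1) tw(3)] gauge_fun_nonneg by (intro mult_left_mono)
    with G1 have cG: "c * ?g x \<le> ?G t x" by (simp add: mult.commute)
    have "?g x - ?G t x \<le> ?g x * (1 - shrink (t * weight u))" using G1 by (simp add: algebra_simps)
    also have "\<dots> \<le> ?g x * (t * W / p)"
      using shrink_bounds(3)[OF tw(1)] divide_right_mono[OF tw(2), of p] p gauge_fun_nonneg
      by (intro mult_left_mono) auto
    finally have y: "?g x - ?G t x \<le> t * (W / p * ?g x)" by (simp add: mult_ac)
    have "exp (- ?G t x) - exp (- ?g x) = exp (- ?g x) * (exp (?g x - ?G t x) - 1)"
      by (simp add: right_diff_distrib exp_add[symmetric])
    also have "\<dots> \<le> exp (- ?g x) * ((?g x - ?G t x) * exp (?g x - ?G t x))"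
      by (intro mult_left_mono exp_minus_one_bounds) auto
    also have "\<dots> = exp (- ?G t x) * (?g x - ?G t x)"
      by (simp add: mult_ac exp_add[symmetric])
    also have "\<dots> \<le> exp (- (c * ?g x)) * (t * (W / p * ?g x))"
      using y cG le by (intro mult_mono) auto
    finally have "exp (- ?G t x) - exp (- ?g x) \<le> t * B x" by (simp add: B_def mult_ac)
    moreover have "0 \<le> exp (- ?G t x) - exp (- ?g x)" using le by simp
    ultimately show ?thesis using t by (simp add: pos_divide_le_eq mult.commute)
  qed
  have lim: "AE x in lborel. ((\<lambda>t. (exp (- ?G t x) - exp (- ?g x)) / t) \<longlongrightarrow>
      exp (- ?g x) * (?g x * weight (outer_normal x) / p)) (at_right 0)"
    using AE_unique_maximiser
  proof eventually_elim
    case (elim x)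
    let ?y = "\<lambda>t. ?g x - ?G t x"
    have pos: "eventually (\<lambda>t::real. 0 < t) (at_right 0)" by (simp add: eventually_at_right_less)
    have y: "((\<lambda>t. ?y t / t) \<longlongrightarrow> ?g x * weight (outer_normal x) / p) (at_right 0)"
      by (rule tendsto_gauge_fun_perturbed[OF elim])
    have "((\<lambda>t. ?y t / t * t) \<longlongrightarrow> ?g x * weight (outer_normal x) / p * 0) (at_right 0)"
      by (intro tendsto_mult y tendsto_ident_at)
    then have "((\<lambda>t. ?y t / t * t) \<longlongrightarrow> 0) (at_right 0)" by simp
    then have y0: "(?y \<longlongrightarrow> 0) (at_right 0)"
      by (rule Lim_transform_eventually) (use pos in eventually_elim, simp)
    have "((\<lambda>t. (exp (?y t) - 1) / t) \<longlongrightarrow> ?g x * weight (outer_normal x) / p) (at_right 0)"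
    proof (rule tendsto_sandwich[OF _ _ y])
      show "eventually (\<lambda>t. ?y t / t \<le> (exp (?y t) - 1) / t) (at_right 0)"
        using pos by eventually_elim (intro divide_right_mono exp_minus_one_bounds, simp)
      show "eventually (\<lambda>t. (exp (?y t) - 1) / t \<le> ?y t / t * exp (?y t)) (at_right 0)"
        using pos
      proof eventually_elim
        case (elim t)
        then show ?case using exp_minus_one_bounds(2)[of "?y t"] by (simp add: divide_right_mono)
      qed
      have "((\<lambda>t. ?y t / t * exp (?y t)) \<longlongrightarrow> ?g x * weight (outer_normal x) / p * exp 0) (at_right 0)"
        by (intro tendsto_mult y tendsto_exp y0)
      then show "((\<lambda>t. ?y t / t * exp (?y t)) \<longlongrightarrow> ?g x * weight (outer_normal x) / p) (at_right 0)" by simp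
    qed
    then have "((\<lambda>t. exp (- ?g x) * ((exp (?y t) - 1) / t)) \<longlongrightarrow>
        exp (- ?g x) * (?g x * weight (outer_normal x) / p)) (at_right 0)"
      by (intro tendsto_mult tendsto_const)
    moreover have "exp (- ?g x) * ((exp (?y t) - 1) / t) = (exp (- ?G t x) - exp (- ?g x)) / t" for t
      by (simp add: right_diff_distrib exp_add[symmetric])
    ultimately show ?case by (simp only:)
  qed
  \<comment> \<open>Restricting to [0, 1] makes every approximating sequence satisfy t \<le> 1, as
    the domination requires.\<close>
  have at: "at_right (0::real) = at 0 within {0..1}" by (rule at_within_Icc_at_right[symmetric]) simp
  show ?thesis
    unfolding at tendsto_at_iff_sequentially comp_def
  proof (intro allI impI integral_dominated_convergence[OF _ _ intB])
    fix X :: "nat \<Rightarrow> real" assume X: "\<forall>i. X i \<in> {0..1} - {0}" "X \<longlonglongrightarrow> 0"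
    show "AE x in lborel. (\<lambda>i. (exp (- ?G (X i) x) - exp (- ?g x)) / X i) \<longlonglongrightarrow>
        exp (- ?g x) * (?g x * weight (outer_normal x) / p)"
      using lim unfolding at tendsto_at_iff_sequentially comp_def by eventually_elim (use X in blast)
    show "AE x in lborel. norm ((exp (- ?G (X i) x) - exp (- ?g x)) / X i) \<le> B x" for i
    proof (rule AE_I2, rule le)
      show "0 < X i" "X i \<le> 1" using X(1)[rule_format, of i] by auto
    qed
  qed (use G in simp_all)
qed

text \<open>The finite measure is concentrated on the compact dual sphere, where the integrand is
  bounded.\<close>

lemma integrable_support_fun_powr: "integrable surface_measure (\<lambda>u. support_fun M u powr p)"
proof -
  obtain W where W: "0 < W" "\<And>u. u \<in> dual_sphere S \<Longrightarrow> weight u \<le> W" using weight_bounded by blast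
  have "integrable surface_measure weight"
  proof (rule finite_measure.integrable_const_bound[OF finite_measure_surface_measure, where B = W])
    show "AE u in surface_measure. norm (weight u) \<le> W"
      unfolding surface_measure_def
    proof (subst AE_distr_iff)
      show "AE x in density lborel (\<lambda>x. ennreal (exp (- gauge_fun S x) * gauge_fun S x / (DIM('d) * fact DIM('d)))).
          norm (weight (outer_normal x)) \<le> W"
      proof (subst AE_density)
        show "AE x in lborel. 0 < ennreal (exp (- gauge_fun S x) * gauge_fun S x / (DIM('d) * fact DIM('d))) \<longrightarrow>
            norm (weight (outer_normal x)) \<le> W"
          using outer_normal_in_dual_sphere
          by eventually_elim (use W weight_nonneg in auto)
      qed simp
    qed simp_all
  qed (simp add: measurable_cong_sets[OF sets_surface_measure refl])
  then show ?thesis by (simp add: weight_def[abs_def])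
qed

lemma Lp_mixed_volume_eq: "Lp_mixed_volume p S M = (\<integral>u. support_fun M u powr p \<partial>surface_measure)"
proof -
  let ?I = "\<integral>x. exp (- gauge_fun S x) * (gauge_fun S x * weight (outer_normal x) / p) \<partial>lborel"
  have quotient: "(measure lebesgue (perturbed t) - measure lebesgue S) / t =
      (\<integral>x. (exp (- gauge_fun (perturbed t) x) - exp (- gauge_fun S x)) / t \<partial>lborel) / fact DIM('d)" for t
  proof -
    interpret P: body_around_origin "perturbed t" by (rule body_around_origin_perturbed)
    have "integrable lborel (\<lambda>x. exp (- gauge_fun (perturbed t) x))"
      "integrable lborel (\<lambda>x. exp (- gauge_fun S x))"
      using P.integrable_exp_gauge_fun[of 1] integrable_exp_gauge_fun[of 1] by simp_all
    then show ?thesis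
      by (simp add: P.measure_eq_integral_exp_gauge_fun measure_eq_integral_exp_gauge_fun
          diff_divide_distrib mult.commute)
  qed
  have "((\<lambda>t. (measure lebesgue (perturbed t) - measure lebesgue S) / t) \<longlongrightarrow> ?I / fact DIM('d)) (at_right 0)"
    unfolding quotient by (intro tendsto_divide tendsto_integral_perturbed tendsto_const) simp
  then have "Lp_mixed_volume p S M = p / DIM('d) * (?I / fact DIM('d))"
    unfolding Lp_mixed_volume_def perturbed_def[symmetric]
    by (subst tendsto_Lim[OF trivial_limit_at_right_real]) auto
  also have "\<dots> = (\<integral>x. exp (- gauge_fun S x) * gauge_fun S x / (DIM('d) * fact DIM('d)) * weight (outer_normal x) \<partial>lborel)"
    using p by (simp flip: integral_mult_right_zero integral_divide_zero add: field_simps)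
  also have "\<dots> = (\<integral>x. weight (outer_normal x) \<partial>density lborel
      (\<lambda>x. ennreal (exp (- gauge_fun S x) * gauge_fun S x / (DIM('d) * fact DIM('d)))))"
    using gauge_fun_nonneg by (subst integral_density) (auto simp: mult_ac)
  also have "\<dots> = (\<integral>u. weight u \<partial>surface_measure)"
    unfolding surface_measure_def by (subst integral_distr) auto
  finally show ?thesis by (simp add: weight_def)
qed

end

end

section \<open>A maximal inequality\<close>

text \<open>Group the family into the disjoint singletons {f j} and project. It serves to reverse
  the order of increments.\<close>

lemma (in prob_space) indep_vars_reindex_on:
  assumes X: "indep_vars (\<lambda>_. N) X I" and f: "inj_on f J" "f ` J \<subseteq> I"
  shows "indep_vars (\<lambda>_. N) (\<lambda>j. X (f j)) J"
proof -
  have "indep_vars (\<lambda>j. PiM {f j} (\<lambda>_. N)) (\<lambda>j \<omega>. restrict (\<lambda>i. X i \<omega>) {f j}) J"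
    using f by (intro indep_vars_restrict[OF X]) (auto simp: disjoint_family_on_def inj_on_def)
  then have "indep_vars (\<lambda>_. N) (\<lambda>j \<omega>. (\<lambda>g. g (f j)) (restrict (\<lambda>i. X i \<omega>) {f j})) J"
    by (rule indep_vars_compose2) simp
  then show ?thesis by simp
qed

text \<open>Lindley's recursion computes the maximum of the partial sums of \<open>y\<close> in reversed order.
  In this form the last increment enters through a single independent variable.\<close>

primrec lindley :: "(nat \<Rightarrow> real) \<Rightarrow> nat \<Rightarrow> real" where
  "lindley y 0 = 0"
| "lindley y (Suc n) = max 0 (lindley y n + y n)"

lemma lindley_nonneg: "0 \<le> lindley y n"
  by (cases n) auto

lemma lindley_cong: "(\<And>i. i < n \<Longrightarrow> y i = z i) \<Longrightarrow> lindley y n = lindley z n"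
  by (induction n) auto

lemma lindley_mult: "0 \<le> c \<Longrightarrow> lindley (\<lambda>i. c * y i) n = c * lindley y n"
proof (induction n)
  case (Suc n)
  then show ?case by (simp add: distrib_left[symmetric] max_mult_distrib_left)
qed simp

lemma measurable_lindley [measurable (raw)]:
  "(\<And>i. i < n \<Longrightarrow> (\<lambda>\<omega>. \<xi> i \<omega>) \<in> borel_measurable M) \<Longrightarrow> (\<lambda>\<omega>. lindley (\<lambda>i. \<xi> i \<omega>) n) \<in> borel_measurable M"
  by (induction n) auto

text \<open>The range of j is for the induction: adding the point n - Suc j on the left shifts the
  reference value by the new increment and truncates at 0. For j = n this is the maximum over the
  grid relative to f 0.\<close>

lemma lindley_reversed_increments:
  fixes f :: "nat \<Rightarrow> real"
  assumes "j \<le> n"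
  shows "lindley (\<lambda>i. f (n - i) - f (n - Suc i)) j = (MAX k\<in>{n - j..n}. f k) - f (n - j)"
  using assms
proof (induction j)
  case (Suc j)
  have "{n - Suc j..n} = insert (n - Suc j) {n - j..n}" using Suc.prems by auto
  then have "(MAX k\<in>{n - Suc j..n}. f k) = max (f (n - Suc j)) (MAX k\<in>{n - j..n}. f k)"
    using Suc.prems by (simp add: Max_insert)
  then show ?case using Suc by (simp add: max_def)
qed simp

lemma symmetric_half_line:
  fixes \<nu> :: "real measure"
  assumes "prob_space \<nu>" "sets \<nu> = sets borel" "distr \<nu> borel uminus = \<nu>" "x \<le> 0"
  shows "1 \<le> 2 * emeasure \<nu> {x..}"
proof -
  interpret prob_space \<nu> by fact
  have [measurable_cong]: "sets \<nu> = sets borel" by fact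
  have sp: "space \<nu> = UNIV" using sets_eq_imp_space_eq[OF assms(2)] by simp
  have "emeasure \<nu> {..0} = emeasure (distr \<nu> borel uminus) {..0}" using assms by simp
  also have "\<dots> = emeasure \<nu> (uminus -` {..0} \<inter> space \<nu>)" by (subst emeasure_distr) auto
  also have "uminus -` {..0} \<inter> space \<nu> = {0::real..}" by (auto simp: sp)
  finally have sym: "emeasure \<nu> {..0} = emeasure \<nu> {0..}" .
  have "{0..} \<union> {..0} = (UNIV :: real set)" by auto
  then have "1 = emeasure \<nu> ({0..} \<union> {..0})" using emeasure_space_1 sp by simp
  also have "\<dots> \<le> emeasure \<nu> {0..} + emeasure \<nu> {..0}" by (rule emeasure_subadditive) auto
  also have "\<dots> = 2 * emeasure \<nu> {0..}" by (simp add: sym mult_2)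
  also have "\<dots> \<le> 2 * emeasure \<nu> {x..}" using assms(4) by (intro mult_left_mono emeasure_mono) auto
  finally show ?thesis .
qed

context prob_space
begin

text \<open>The second condition on f allows replacing the whole sequence by its restriction to the
  first n indices, which is independent of the last variable.\<close>

lemma distr_pair_last:
  fixes f :: "(nat \<Rightarrow> real) \<Rightarrow> real" and \<xi> :: "nat \<Rightarrow> 'a \<Rightarrow> real"
  assumes ind: "indep_vars (\<lambda>_. borel) \<xi> {..<Suc n}"
    and f: "f \<in> borel_measurable (PiM {..<n} (\<lambda>_. borel))"
      "\<And>y z. (\<And>i. i < n \<Longrightarrow> y i = z i) \<Longrightarrow> f y = f z"
  shows "distr M (borel \<Otimes>\<^sub>M borel) (\<lambda>\<omega>. (f (\<lambda>i. \<xi> i \<omega>), \<xi> n \<omega>)) =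
    distr M borel (\<lambda>\<omega>. f (\<lambda>i. \<xi> i \<omega>)) \<Otimes>\<^sub>M distr M borel (\<xi> n)"
proof -
  have "indep_var (PiM {..<n} (\<lambda>_. borel)) (\<lambda>\<omega>. restrict (\<lambda>i. \<xi> i \<omega>) {..<n})
      (PiM {n} (\<lambda>_. borel)) (\<lambda>\<omega>. restrict (\<lambda>i. \<xi> i \<omega>) {n})"
    by (rule indep_var_restrict[OF ind]) auto
  then have "indep_var borel (f \<circ> (\<lambda>\<omega>. restrict (\<lambda>i. \<xi> i \<omega>) {..<n}))
      borel ((\<lambda>g. g n) \<circ> (\<lambda>\<omega>. restrict (\<lambda>i. \<xi> i \<omega>) {n}))"
    by (rule indep_var_compose) (use f in auto)
  also have "f \<circ> (\<lambda>\<omega>. restrict (\<lambda>i. \<xi> i \<omega>) {..<n}) = (\<lambda>\<omega>. f (\<lambda>i. \<xi> i \<omega>))"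
    by (auto simp: fun_eq_iff intro!: f(2))
  also have "(\<lambda>g. g n) \<circ> (\<lambda>\<omega>. restrict (\<lambda>i. \<xi> i \<omega>) {n}) = \<xi> n" by auto
  finally show ?thesis by (simp add: indep_var_distribution_eq)
qed

lemma indep_vars_random_variable: "indep_vars M' X I \<Longrightarrow> i \<in> I \<Longrightarrow> X i \<in> measurable M (M' i)"
  by (simp add: indep_vars_def)

lemma distr_lindley_Suc:
  fixes \<xi> :: "nat \<Rightarrow> 'a \<Rightarrow> real"
  assumes ind: "indep_vars (\<lambda>_. borel) \<xi> {..<Suc n}"
  shows "distr M borel (\<lambda>\<omega>. lindley (\<lambda>i. \<xi> i \<omega>) (Suc n)) =
    distr (distr M borel (\<lambda>\<omega>. lindley (\<lambda>i. \<xi> i \<omega>) n) \<Otimes>\<^sub>M distr M borel (\<xi> n)) borel (\<lambda>(m, y). max 0 (m + y))"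
proof -
  have [measurable]: "i < Suc n \<Longrightarrow> \<xi> i \<in> borel_measurable M" for i
    using indep_vars_random_variable[OF ind] by simp
  have [measurable]: "i < n \<Longrightarrow> \<xi> i \<in> borel_measurable M" for i by simp
  show ?thesis
    by (subst distr_pair_last[OF ind, of "\<lambda>y. lindley y n", symmetric])
      (auto simp: distr_distr comp_def intro: lindley_cong)
qed

lemma distr_sum_Suc:
  fixes \<xi> :: "nat \<Rightarrow> 'a \<Rightarrow> real"
  assumes ind: "indep_vars (\<lambda>_. borel) \<xi> {..<Suc n}"
  shows "distr M borel (\<lambda>\<omega>. \<Sum>i<Suc n. \<xi> i \<omega>) =
    distr (distr M borel (\<lambda>\<omega>. \<Sum>i<n. \<xi> i \<omega>) \<Otimes>\<^sub>M distr M borel (\<xi> n)) borel (\<lambda>(m, y). m + y)"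
proof -
  have [measurable]: "i < Suc n \<Longrightarrow> \<xi> i \<in> borel_measurable M" for i
    using indep_vars_random_variable[OF ind] by simp
  have [measurable]: "i < n \<Longrightarrow> \<xi> i \<in> borel_measurable M" for i by simp
  show ?thesis
    by (subst distr_pair_last[OF ind, of "\<lambda>y. \<Sum>i<n. y i", symmetric])
      (auto simp: distr_distr comp_def intro: sum.cong)
qed

text \<open>Each step of the recursion is the image of a product of laws under a fixed map, so
  equality of laws passes from n to Suc n even across different probability spaces.\<close>

lemma distr_lindley_eq:
  fixes \<xi> :: "nat \<Rightarrow> 'a \<Rightarrow> real" and \<eta> :: "nat \<Rightarrow> 'b \<Rightarrow> real"
  assumes "prob_space N"
    and "indep_vars (\<lambda>_. borel) \<xi> {..<n}" "prob_space.indep_vars N (\<lambda>_. borel) \<eta> {..<n}"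
    and "\<And>i. i < n \<Longrightarrow> distr M borel (\<xi> i) = distr N borel (\<eta> i)"
  shows "distr M borel (\<lambda>\<omega>. lindley (\<lambda>i. \<xi> i \<omega>) n) = distr N borel (\<lambda>\<omega>. lindley (\<lambda>i. \<eta> i \<omega>) n)"
  using assms(2-)
proof (induction n)
  case 0
  interpret N: prob_space N by fact
  have "distr M borel (\<lambda>_. 0) = return borel 0" "distr N borel (\<lambda>_. 0) = return borel (0::real)"
    by (simp_all add: distr_const N.distr_const)
  then show ?case by simp
next
  case (Suc n)
  interpret N: prob_space N by fact
  have "indep_vars (\<lambda>_. borel) \<xi> {..<n}" "N.indep_vars (\<lambda>_. borel) \<eta> {..<n}"
    using Suc.prems by (auto intro: indep_vars_subset N.indep_vars_subset)
  with Suc show ?case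
    by (simp only: distr_lindley_Suc[OF Suc.prems(1)] N.distr_lindley_Suc[OF Suc.prems(2)])
qed

text \<open>The product of two symmetric laws is invariant under joint negation, which commutes with
  addition.\<close>

lemma symmetric_sum:
  fixes \<xi> :: "nat \<Rightarrow> 'a \<Rightarrow> real"
  assumes "indep_vars (\<lambda>_. borel) \<xi> {..<n}"
    and "\<And>i. i < n \<Longrightarrow> distr (distr M borel (\<xi> i)) borel uminus = distr M borel (\<xi> i)"
  shows "distr (distr M borel (\<lambda>\<omega>. \<Sum>i<n. \<xi> i \<omega>)) borel uminus = distr M borel (\<lambda>\<omega>. \<Sum>i<n. \<xi> i \<omega>)"
  using assms
proof (induction n)
  case 0
  then show ?case by (simp add: distr_return)
next
  case (Suc n)
  have [measurable]: "i < Suc n \<Longrightarrow> \<xi> i \<in> borel_measurable M" for i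
    using indep_vars_random_variable[OF Suc.prems(1)] by simp
  have [measurable]: "i < n \<Longrightarrow> \<xi> i \<in> borel_measurable M" for i by simp
  let ?A = "distr M borel (\<lambda>\<omega>. \<Sum>i<n. \<xi> i \<omega>)" and ?B = "distr M borel (\<xi> n)"
  interpret A: prob_space ?A by (rule prob_space_distr) simp
  interpret B: prob_space ?B by (rule prob_space_distr) simp
  have A: "distr ?A borel uminus = ?A"
    using Suc by (intro Suc.IH) (auto intro: indep_vars_subset)
  have B: "distr ?B borel uminus = ?B" using Suc.prems(2)[of n] by simp
  have "?A \<Otimes>\<^sub>M ?B = distr ?A borel uminus \<Otimes>\<^sub>M distr ?B borel uminus" using A B by simp
  also have "\<dots> = distr (?A \<Otimes>\<^sub>M ?B) (borel \<Otimes>\<^sub>M borel) (\<lambda>(x, y). (- x, - y))"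
    by (rule pair_measure_distr) (simp_all add: B B.sigma_finite_measure_axioms)
  finally have eq: "?A \<Otimes>\<^sub>M ?B = distr (?A \<Otimes>\<^sub>M ?B) (borel \<Otimes>\<^sub>M borel) (\<lambda>(x, y). (- x, - y))" .
  have "distr (distr (?A \<Otimes>\<^sub>M ?B) borel (\<lambda>(m, y). m + y)) borel uminus =
      distr (distr (?A \<Otimes>\<^sub>M ?B) (borel \<Otimes>\<^sub>M borel) (\<lambda>(x, y). (- x, - y))) borel (\<lambda>(m, y). m + y)"
    by (simp add: distr_distr comp_def case_prod_beta)
  also have "\<dots> = distr (?A \<Otimes>\<^sub>M ?B) borel (\<lambda>(m, y). m + y)" by (simp only: eq[symmetric])
  finally show ?case unfolding distr_sum_Suc[OF Suc.prems(1)] .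
qed

text \<open>The bound is stated for all real \<open>x\<close>: for \<open>x \<le> 0\<close> its right-hand side is at least \<open>1\<close> by
  symmetry, which the inductive step needs when the last increment exceeds \<open>x\<close>.\<close>

lemma levy_maximal_inequality:
  fixes \<xi> :: "nat \<Rightarrow> 'a \<Rightarrow> real"
  assumes "indep_vars (\<lambda>_. borel) \<xi> {..<n}"
    and "\<And>i. i < n \<Longrightarrow> distr (distr M borel (\<xi> i)) borel uminus = distr M borel (\<xi> i)"
  shows "emeasure (distr M borel (\<lambda>\<omega>. lindley (\<lambda>i. \<xi> i \<omega>) n)) {x..} \<le>
    2 * emeasure (distr M borel (\<lambda>\<omega>. \<Sum>i<n. \<xi> i \<omega>)) {x..}"
  using assms
proof (induction n arbitrary: x)
  case 0
  show ?case by (simp add: mult_2)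
next
  case (Suc n)
  have [measurable]: "i < Suc n \<Longrightarrow> \<xi> i \<in> borel_measurable M" for i
    using indep_vars_random_variable[OF Suc.prems(1)] by simp
  have [measurable]: "i < n \<Longrightarrow> \<xi> i \<in> borel_measurable M" for i by simp
  let ?m = "distr M borel (\<lambda>\<omega>. lindley (\<lambda>i. \<xi> i \<omega>) n)"
  let ?A = "distr M borel (\<lambda>\<omega>. \<Sum>i<n. \<xi> i \<omega>)" and ?B = "distr M borel (\<xi> n)"
  interpret m: prob_space ?m by (rule prob_space_distr) simp
  interpret A: prob_space ?A by (rule prob_space_distr) simp
  interpret B: prob_space ?B by (rule prob_space_distr) simp
  interpret mB: pair_sigma_finite ?m ?B ..
  interpret AB: pair_sigma_finite ?A ?B ..
  show ?case
  proof (cases "x \<le> 0")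
    case True
    have "1 \<le> 2 * emeasure (distr M borel (\<lambda>\<omega>. \<Sum>i<Suc n. \<xi> i \<omega>)) {x..}"
      by (rule symmetric_half_line[OF prob_space_distr _ symmetric_sum[OF Suc.prems] True]) simp_all
    moreover have "emeasure (distr M borel (\<lambda>\<omega>. lindley (\<lambda>i. \<xi> i \<omega>) (Suc n))) {x..} \<le> 1"
      by (intro prob_space.emeasure_le_1 prob_space_distr) simp
    ultimately show ?thesis by (rule order_trans[rotated])
  next
    case False
    have ind: "indep_vars (\<lambda>_. borel) \<xi> {..<n}"
      using Suc.prems(1) by (auto intro: indep_vars_subset)
    have set: "{z \<in> space (borel \<Otimes>\<^sub>M borel). x \<le> fst z + snd z} \<in> sets (borel \<Otimes>\<^sub>M (borel :: real measure))"
      by measurable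
    let ?Q = "{z. x \<le> fst z + snd z}"
    have Q: "?Q \<in> sets (?m \<Otimes>\<^sub>M ?B)" "?Q \<in> sets (?A \<Otimes>\<^sub>M ?B)"
      using set by (simp_all add: space_pair_measure)
    \<comment> \<open>Here x > 0, so the truncation at 0 does not affect the event.\<close>
    have "emeasure (distr M borel (\<lambda>\<omega>. lindley (\<lambda>i. \<xi> i \<omega>) (Suc n))) {x..} = emeasure (?m \<Otimes>\<^sub>M ?B) ?Q"
      unfolding distr_lindley_Suc[OF Suc.prems(1)] using False
      by (subst emeasure_distr) (auto intro!: arg_cong[where f="emeasure _"] simp: space_pair_measure)
    also have "\<dots> = (\<integral>\<^sup>+y. emeasure ?m {x - y..} \<partial>?B)"
      by (subst mB.emeasure_pair_measure_alt2[OF Q(1)])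
        (auto intro!: nn_integral_cong arg_cong[where f="emeasure _"])
    also have "\<dots> \<le> (\<integral>\<^sup>+y. 2 * emeasure ?A {x - y..} \<partial>?B)"
      using Suc.prems(2) by (intro nn_integral_mono Suc.IH ind) auto
    also have "\<dots> = 2 * (\<integral>\<^sup>+y. emeasure ?A ((\<lambda>x. (x, y)) -` ?Q) \<partial>?B)"
      using AB.measurable_emeasure_Pair2[OF Q(2)]
      by (subst nn_integral_cmult[symmetric])
        (auto intro!: nn_integral_cong arg_cong[where f="\<lambda>S. 2 * emeasure _ S"])
    also have "\<dots> = 2 * emeasure (?A \<Otimes>\<^sub>M ?B) ?Q"
      by (simp only: AB.emeasure_pair_measure_alt2[OF Q(2)])
    also have "\<dots> = 2 * emeasure (distr M borel (\<lambda>\<omega>. \<Sum>i<Suc n. \<xi> i \<omega>)) {x..}"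
      unfolding distr_sum_Suc[OF Suc.prems(1)]
      by (subst emeasure_distr) (auto intro!: arg_cong[where f="\<lambda>S. 2 * emeasure _ S"] simp: space_pair_measure)
    finally show ?thesis .
  qed
qed

text \<open>Layer cake on both sides. Only positive levels occur, because \<open>ennreal\<close>
  sends negative values to 0.\<close>

lemma nn_integral_le_tail:
  fixes A B :: "'a \<Rightarrow> real"
  assumes [measurable]: "A \<in> borel_measurable M" "B \<in> borel_measurable M"
    and tail: "\<And>x. 0 < x \<Longrightarrow> emeasure M {\<omega>\<in>space M. x \<le> A \<omega>} \<le> c * emeasure M {\<omega>\<in>space M. x \<le> B \<omega>}"
  shows "(\<integral>\<^sup>+\<omega>. ennreal (A \<omega>) \<partial>M) \<le> c * (\<integral>\<^sup>+\<omega>. ennreal (B \<omega>) \<partial>M)"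
proof -
  interpret pair_sigma_finite M "lborel :: real measure" ..
  have cake: "(\<integral>\<^sup>+\<omega>. ennreal (f \<omega>) \<partial>M) =
      (\<integral>\<^sup>+x. indicator {0<..} x * emeasure M {\<omega>\<in>space M. x \<le> f \<omega>} \<partial>lborel)"
    if [measurable]: "f \<in> borel_measurable M" for f :: "'a \<Rightarrow> real"
  proof -
    have "(\<integral>\<^sup>+\<omega>. ennreal (f \<omega>) \<partial>M) = (\<integral>\<^sup>+\<omega>. \<integral>\<^sup>+x. indicator {0<..f \<omega>} x \<partial>lborel \<partial>M)"
    proof (rule nn_integral_cong)
      show "ennreal (f \<omega>) = (\<integral>\<^sup>+x. indicator {0<..f \<omega>} x \<partial>lborel)" for \<omega>
        by (cases "0 \<le> f \<omega>") (simp_all add: ennreal_neg)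
    qed
    also have "\<dots> = (\<integral>\<^sup>+x. \<integral>\<^sup>+\<omega>. indicator {0<..f \<omega>} x \<partial>M \<partial>lborel)"
    proof (rule Fubini'[symmetric])
      have "(\<lambda>(\<omega>, x). indicator {0<..f \<omega>} x :: ennreal) =
          indicator {z. 0 < snd z \<and> snd z \<le> f (fst z)}"
        by (auto simp: fun_eq_iff indicator_def)
      moreover have "(\<lambda>z. indicator {z. 0 < snd z \<and> snd z \<le> f (fst z)} z :: ennreal)
          \<in> borel_measurable (M \<Otimes>\<^sub>M lborel)"
        by measurable
      ultimately show "(\<lambda>(\<omega>, x). indicator {0<..f \<omega>} x :: ennreal) \<in> borel_measurable (M \<Otimes>\<^sub>M lborel)"
        by simp
    qed
    also have "\<dots> = (\<integral>\<^sup>+x. \<integral>\<^sup>+\<omega>. indicator {0<..} x * indicator {\<omega>\<in>space M. x \<le> f \<omega>} \<omega> \<partial>M \<partial>lborel)"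
      by (intro nn_integral_cong) (auto simp: indicator_def)
    also have "\<dots> = (\<integral>\<^sup>+x. indicator {0<..} x * emeasure M {\<omega>\<in>space M. x \<le> f \<omega>} \<partial>lborel)"
      by (intro nn_integral_cong) (simp add: nn_integral_cmult)
    finally show ?thesis .
  qed
  have meas: "(\<lambda>x. indicator {0<..} x * emeasure M {\<omega>\<in>space M. x \<le> B \<omega>}) \<in> borel_measurable lborel"
    by measurable
  have "(\<integral>\<^sup>+\<omega>. ennreal (A \<omega>) \<partial>M) \<le>
      (\<integral>\<^sup>+x. c * (indicator {0<..} x * emeasure M {\<omega>\<in>space M. x \<le> B \<omega>}) \<partial>lborel)"
    unfolding cake[OF assms(1)]
    by (intro nn_integral_mono) (auto simp: indicator_def intro!: tail)
  also have "\<dots> = c * (\<integral>\<^sup>+\<omega>. ennreal (B \<omega>) \<partial>M)"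
    unfolding cake[OF assms(2)] by (rule nn_integral_cmult[OF meas])
  finally show ?thesis .
qed

text \<open>The maximal inequality is applied at every level. The factor 2 does not depend on n, so
  the bound survives refining a grid.\<close>

lemma nn_integral_lindley_powr_le:
  fixes \<xi> :: "nat \<Rightarrow> 'a \<Rightarrow> real"
  assumes ind: "indep_vars (\<lambda>_. borel) \<xi> {..<n}"
    and sym: "\<And>i. i < n \<Longrightarrow> distr (distr M borel (\<xi> i)) borel uminus = distr M borel (\<xi> i)"
    and p: "0 < p"
  shows "(\<integral>\<^sup>+\<omega>. ennreal (lindley (\<lambda>i. \<xi> i \<omega>) n powr p) \<partial>M) \<le>
    2 * (\<integral>\<^sup>+\<omega>. ennreal (\<bar>\<Sum>i<n. \<xi> i \<omega>\<bar> powr p) \<partial>M)"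
proof (rule nn_integral_le_tail)
  have [measurable]: "i < n \<Longrightarrow> \<xi> i \<in> borel_measurable M" for i
    using indep_vars_random_variable[OF ind] by simp
  show "(\<lambda>\<omega>. lindley (\<lambda>i. \<xi> i \<omega>) n powr p) \<in> borel_measurable M"
    "(\<lambda>\<omega>. \<bar>\<Sum>i<n. \<xi> i \<omega>\<bar> powr p) \<in> borel_measurable M"
    by measurable
  fix x :: real assume x: "0 < x"
  define y where "y = x powr (1 / p)"
  have y: "0 < y" using x by (simp add: y_def)
  have le_iff: "x \<le> z powr p \<longleftrightarrow> y \<le> z" if "0 \<le> z" for z
  proof -
    have "x = y powr p" using x p by (simp add: y_def powr_powr)
    then show ?thesis
      using that y p powr_mono2[of p y z] powr_less_mono2[of p z y] by (auto simp: not_less[symmetric])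
  qed
  have "emeasure M {\<omega> \<in> space M. x \<le> lindley (\<lambda>i. \<xi> i \<omega>) n powr p} =
      emeasure (distr M borel (\<lambda>\<omega>. lindley (\<lambda>i. \<xi> i \<omega>) n)) {y..}"
    by (subst emeasure_distr) (auto intro!: arg_cong[where f="emeasure M"] simp: le_iff[OF lindley_nonneg])
  also have "\<dots> \<le> 2 * emeasure (distr M borel (\<lambda>\<omega>. \<Sum>i<n. \<xi> i \<omega>)) {y..}"
    by (rule levy_maximal_inequality[OF ind sym])
  also have "\<dots> = 2 * emeasure M {\<omega> \<in> space M. y \<le> (\<Sum>i<n. \<xi> i \<omega>)}"
    by (subst emeasure_distr) (auto intro!: arg_cong[where f="\<lambda>S. 2 * emeasure M S"])
  also have "\<dots> \<le> 2 * emeasure M {\<omega> \<in> space M. x \<le> \<bar>\<Sum>i<n. \<xi> i \<omega>\<bar> powr p}"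
    by (intro mult_left_mono emeasure_mono) (auto simp: le_iff)
  finally show "emeasure M {\<omega> \<in> space M. x \<le> lindley (\<lambda>i. \<xi> i \<omega>) n powr p} \<le>
      2 * emeasure M {\<omega> \<in> space M. x \<le> \<bar>\<Sum>i<n. \<xi> i \<omega>\<bar> powr p}" .
qed

end

section \<open>Stable laws and suprema over dyadic grids\<close>

text \<open>Keep only s between 1/|x| and 2/|x|. There s|x| lies in [1, 2], so the cosine is at most
  cos 1, the power of s is at least its value at 2/|x|, and the interval has length 1/|x|. The
  condition |x| > 2 places it inside [0, 1].\<close>

lemma integral_one_minus_cos_ge:
  fixes x p :: real
  assumes p: "0 < p" and x: "2 < \<bar>x\<bar>"
  shows "ennreal ((1 - cos 1) * 2 powr (- 1 - p) * \<bar>x\<bar> powr p) \<le>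
    (\<integral>\<^sup>+s. ennreal ((1 - cos (s * x)) * s powr (- 1 - p)) * indicator {0..1} s \<partial>lborel)"
proof -
  let ?y = "\<bar>x\<bar>"
  define b where "b = (1 - cos 1) * (2 / ?y) powr (- 1 - p)"
  have cos1: "cos 1 \<le> (1::real)" by simp
  have b: "0 \<le> b" unfolding b_def by simp
  have le: "b \<le> (1 - cos (s * x)) * s powr (- 1 - p)" if "1 / ?y \<le> s" "s \<le> 2 / ?y" for s
  proof -
    have s: "0 < s" using that(1) x by (smt (verit) zero_less_divide_iff)
    have sx: "1 \<le> s * ?y" "s * ?y \<le> 2" using that x by (auto simp: field_simps)
    have "cos (s * x) = cos (s * ?y)" by (simp add: abs_if)
    also have "\<dots> \<le> cos 1" using sx pi_ge_two by (intro cos_monotone_0_pi_le) auto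
    finally show ?thesis
      unfolding b_def using s that p by (intro mult_mono powr_mono2') auto
  qed
  have "(1 - cos 1) * 2 powr (- 1 - p) * ?y powr p = b * (2 / ?y - 1 / ?y)"
  proof -
    have "(2 / ?y) powr (- 1 - p) = 2 powr (- 1 - p) * ?y powr (1 + p)"
    proof -
      have "(2 / ?y) powr (- 1 - p) = 2 powr (- 1 - p) / ?y powr (- (1 + p))" by (simp add: powr_divide)
      then show ?thesis unfolding powr_minus_divide by simp
    qed
    moreover have "?y powr (1 + p) = ?y * ?y powr p" using x by (simp add: powr_add)
    ultimately show ?thesis using x by (simp add: b_def diff_divide_distrib[symmetric])
  qed
  then have "ennreal ((1 - cos 1) * 2 powr (- 1 - p) * ?y powr p) = ennreal b * emeasure lborel {1 / ?y..2 / ?y}"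
    using x b by (simp add: ennreal_mult[symmetric] divide_right_mono)
  also have "\<dots> = (\<integral>\<^sup>+s. ennreal b * indicator {1 / ?y..2 / ?y} s \<partial>lborel)"
    by (simp add: nn_integral_cmult)
  also have "\<dots> \<le> (\<integral>\<^sup>+s. ennreal ((1 - cos (s * x)) * s powr (- 1 - p)) * indicator {0..1} s \<partial>lborel)"
  proof (rule nn_integral_mono)
    fix s
    show "ennreal b * indicator {1 / ?y..2 / ?y} s \<le>
        ennreal ((1 - cos (s * x)) * s powr (- 1 - p)) * indicator {0..1} s"
    proof (cases "s \<in> {1 / ?y..2 / ?y}")
      case True
      then have "0 \<le> s" "s \<le> 1"
        using x by (auto intro: order_trans[of 0 "1 / ?y"] order_trans[of s "2 / ?y" 1])
      with True show ?thesis using le[of s] by (simp add: ennreal_leI)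
    qed simp
  qed
  finally show ?thesis .
qed

text \<open>Integrating \<open>1 - cos (s x)\<close> against \<open>s\<^bsup>-1-p\<^esup>\<close> recovers \<open>\<bar>x\<bar>\<^sup>p\<close> up to a constant, while
  its expectation is \<open>1 - exp (- s\<^sup>\<alpha>) \<le> s\<^sup>\<alpha>\<close>.\<close>

lemma stable_moment_finite:
  fixes \<nu> :: "real measure" and \<alpha> p :: real
  assumes \<nu>: "real_distribution \<nu>" and char: "\<And>s. char \<nu> s = complex_of_real (exp (- (\<bar>s\<bar> powr \<alpha>)))"
    and p: "0 < p" "p < \<alpha>"
  shows "(\<integral>\<^sup>+x. ennreal (\<bar>x\<bar> powr p) \<partial>\<nu>) < \<infinity>"
proof -
  interpret real_distribution \<nu> by fact
  interpret pair_sigma_finite \<nu> "lborel :: real measure" ..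
  define c where "c = (1 - cos 1) * 2 powr (- 1 - p)"
  have "cos 1 < cos (0::real)" using pi_ge_two by (intro cos_monotone_0_pi) auto
  then have c: "0 < c" by (simp add: c_def)
  let ?f = "\<lambda>x s. ennreal ((1 - cos (s * x)) * s powr (- 1 - p)) * indicator {0..1} s"
  have bound: "ennreal (\<bar>x\<bar> powr p) \<le> ennreal (2 powr p) + ennreal (1 / c) * (\<integral>\<^sup>+s. ?f x s \<partial>lborel)" for x
  proof (cases "\<bar>x\<bar> \<le> 2")
    case True
    then have "ennreal (\<bar>x\<bar> powr p) \<le> ennreal (2 powr p)"
      using p by (intro ennreal_leI powr_mono2) auto
    then show ?thesis by (rule order_trans) simp
  next
    case False
    have "ennreal (\<bar>x\<bar> powr p) = ennreal (1 / c) * ennreal (c * \<bar>x\<bar> powr p)"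
      using c by (simp add: ennreal_mult[symmetric])
    also have "\<dots> \<le> ennreal (1 / c) * (\<integral>\<^sup>+s. ?f x s \<partial>lborel)"
      using integral_one_minus_cos_ge[OF p(1), of x] False
      by (intro mult_left_mono) (auto simp: c_def)
    finally show ?thesis by (rule order_trans) simp
  qed
  have inner: "(\<integral>\<^sup>+x. ennreal (1 - cos (s * x)) \<partial>\<nu>) \<le> ennreal (s powr \<alpha>)" if "0 \<le> s" for s
  proof -
    have int: "integrable \<nu> (\<lambda>x. iexp (s * x))" by (rule integrable_iexp) auto
    have icos: "integrable \<nu> (\<lambda>x. cos (s * x))"
      by (rule integrable_const_bound[where B=1]) auto
    have "(\<integral>x. cos (s * x) \<partial>\<nu>) = (\<integral>x. Re (iexp (s * x)) \<partial>\<nu>)"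
      by (simp add: Re_exp)
    also have "\<dots> = Re (char \<nu> s)" unfolding char_def using int by (rule integral_Re)
    finally have "(\<integral>x. cos (s * x) \<partial>\<nu>) = exp (- (s powr \<alpha>))" using that by (simp add: char)
    then have "(\<integral>x. 1 - cos (s * x) \<partial>\<nu>) = 1 - exp (- (s powr \<alpha>))"
      using icos prob_space by simp
    also have "\<dots> \<le> s powr \<alpha>" using exp_ge_add_one_self[of "- (s powr \<alpha>)"] by linarith
    finally have "ennreal (\<integral>x. 1 - cos (s * x) \<partial>\<nu>) \<le> ennreal (s powr \<alpha>)" by (rule ennreal_leI)
    then show ?thesis using icos by (subst nn_integral_eq_integral) auto
  qed
  \<comment> \<open>The exponent \<alpha> - 1 - p exceeds -1 exactly because p < \<alpha>.\<close>
  have fin: "(\<integral>\<^sup>+s. ennreal (s powr (\<alpha> - 1 - p)) * indicator {0..1} s \<partial>lborel) < \<infinity>"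
  proof -
    have "((\<lambda>s. s powr (\<alpha> - 1 - p)) has_integral (1 powr (\<alpha> - 1 - p + 1) / (\<alpha> - 1 - p + 1))) {0..1::real}"
      by (rule has_integral_powr_from_0) (use p in auto)
    then have "((\<lambda>s. if s \<in> {0..1} then s powr (\<alpha> - 1 - p) else 0) has_integral
        (1 powr (\<alpha> - 1 - p + 1) / (\<alpha> - 1 - p + 1))) (UNIV :: real set)"
      by (simp only: has_integral_restrict_UNIV)
    from nn_integral_has_integral_lborel[OF _ _ this]
    have "(\<integral>\<^sup>+s. ennreal (if s \<in> {0..1} then s powr (\<alpha> - 1 - p) else 0) \<partial>lborel) < \<infinity>"
      by simp
    also have "(\<lambda>s. ennreal (if s \<in> {0..1} then s powr (\<alpha> - 1 - p) else 0)) =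
        (\<lambda>s. ennreal (s powr (\<alpha> - 1 - p)) * indicator {0..1} s)"
      by (auto simp: fun_eq_iff indicator_def)
    finally show ?thesis .
  qed
  have meas: "(\<lambda>(x, s). ?f x s) \<in> borel_measurable (\<nu> \<Otimes>\<^sub>M lborel)"
  proof -
    have "(\<lambda>(x, s). ?f x s) = (\<lambda>z. ennreal ((1 - cos (snd z * fst z)) * snd z powr (- 1 - p)) *
        indicator {z. 0 \<le> snd z \<and> snd z \<le> 1} z)"
      by (auto simp: fun_eq_iff indicator_def)
    moreover have "\<dots> \<in> borel_measurable (\<nu> \<Otimes>\<^sub>M lborel)" by measurable
    ultimately show ?thesis by simp
  qed
  have "(\<integral>\<^sup>+x. \<integral>\<^sup>+s. ?f x s \<partial>lborel \<partial>\<nu>) = (\<integral>\<^sup>+s. \<integral>\<^sup>+x. ?f x s \<partial>\<nu> \<partial>lborel)"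
    by (rule Fubini'[OF meas, symmetric])
  also have "\<dots> \<le> (\<integral>\<^sup>+s. ennreal (s powr (\<alpha> - 1 - p)) * indicator {0..1} s \<partial>lborel)"
  proof (rule nn_integral_mono)
    fix s
    show "(\<integral>\<^sup>+x. ?f x s \<partial>\<nu>) \<le> ennreal (s powr (\<alpha> - 1 - p)) * indicator {0..1} s"
    proof (cases "s \<in> {0..1}")
      case True
      then have "(\<integral>\<^sup>+x. ?f x s \<partial>\<nu>) = (\<integral>\<^sup>+x. ennreal (1 - cos (s * x)) \<partial>\<nu>) * ennreal (s powr (- 1 - p))"
        by (simp add: ennreal_mult nn_integral_multc)
      also have "\<dots> \<le> ennreal (s powr \<alpha>) * ennreal (s powr (- 1 - p))"
        using inner True by (intro mult_right_mono) auto
      also have "\<dots> = ennreal (s powr (\<alpha> - 1 - p))"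
        by (simp add: ennreal_mult[symmetric] powr_add[symmetric] algebra_simps)
      finally show ?thesis using True by simp
    qed simp
  qed
  also note fin
  finally have fin': "(\<integral>\<^sup>+x. \<integral>\<^sup>+s. ?f x s \<partial>lborel \<partial>\<nu>) < \<infinity>" .
  have meas': "(\<lambda>x. \<integral>\<^sup>+s. ?f x s \<partial>lborel) \<in> borel_measurable \<nu>"
    using lborel.borel_measurable_nn_integral_fst[OF meas] by simp
  have "(\<integral>\<^sup>+x. ennreal (\<bar>x\<bar> powr p) \<partial>\<nu>) \<le>
      (\<integral>\<^sup>+x. ennreal (2 powr p) + ennreal (1 / c) * (\<integral>\<^sup>+s. ?f x s \<partial>lborel) \<partial>\<nu>)"
    by (intro nn_integral_mono bound)
  also have "\<dots> = ennreal (2 powr p) + ennreal (1 / c) * (\<integral>\<^sup>+x. \<integral>\<^sup>+s. ?f x s \<partial>lborel \<partial>\<nu>)"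
    using meas' emeasure_space_1 by (simp add: nn_integral_add nn_integral_cmult)
  also have "\<dots> < \<infinity>" using fin' by (simp add: ennreal_mult_less_top)
  finally show ?thesis .
qed

text \<open>Subtracting f 0 makes this a function of increments for every path, although a Levy
  process starts at 0 only almost surely.\<close>

definition grid_max :: "(real \<Rightarrow> real) \<Rightarrow> nat \<Rightarrow> real" where
  "grid_max f n = (MAX k\<in>{0..n}. f (real k / real n)) - f 0"

text \<open>Extended-real values keep it meaningful and measurable for every path, before
  boundedness is known. The grids are nested, so monotone convergence applies.\<close>

definition dyadic_sup :: "real \<Rightarrow> (real \<Rightarrow> real) \<Rightarrow> ennreal" where
  "dyadic_sup p f = (SUP k. ennreal (grid_max f (2 ^ k) powr p))"

text \<open>Increments are numbered backwards in time to fit \<open>lindley\<close>.\<close>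

definition grid_increment :: "(real \<Rightarrow> real) \<Rightarrow> nat \<Rightarrow> nat \<Rightarrow> real" where
  "grid_increment f n i = f (real (n - i) / real n) - f (real (n - Suc i) / real n)"

lemma grid_max_eq_lindley: "grid_max f n = lindley (grid_increment f n) n"
  using lindley_reversed_increments[of n n "\<lambda>k. f (real k / real n)"]
  by (simp add: grid_max_def grid_increment_def[abs_def])

lemma grid_max_ge:
  assumes "k \<le> n"
  shows "f (real k / real n) - f 0 \<le> grid_max f n"
  using assms unfolding grid_max_def by (intro diff_right_mono Max_ge) auto

lemma grid_max_double: "grid_max f n \<le> grid_max f (2 * n)"
proof -
  have "(\<lambda>k. f (real k / real n)) ` {0..n} \<subseteq> (\<lambda>k. f (real k / real (2 * n))) ` {0..2 * n}"
  proof
    fix y assume "y \<in> (\<lambda>k. f (real k / real n)) ` {0..n}"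
    then obtain k where "k \<le> n" "y = f (real k / real n)" by auto
    then show "y \<in> (\<lambda>k. f (real k / real (2 * n))) ` {0..2 * n}"
      by (intro image_eqI[of _ _ "2 * k"]) auto
  qed
  then show ?thesis unfolding grid_max_def by (intro diff_right_mono Max_mono) auto
qed

lemma incseq_grid_max: "0 < p \<Longrightarrow> incseq (\<lambda>k. ennreal (grid_max f (2 ^ k) powr p))"
  using grid_max_double[of f "2 ^ k" for k]
  by (intro incseq_SucI ennreal_leI powr_mono2) (auto simp: grid_max_eq_lindley lindley_nonneg)

text \<open>A point t < 1 is approached by dyadic points from the right, while t = 1 is itself a
  grid point.\<close>

lemma right_continuous_le_of_dyadic:
  fixes f :: "real \<Rightarrow> real"
  assumes cont: "\<And>t. 0 \<le> t \<Longrightarrow> continuous (at_right t) f"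
    and le: "\<And>k j. j \<le> 2 ^ k \<Longrightarrow> f (real j / 2 ^ k) \<le> C"
    and t: "t \<in> {0..1}"
  shows "f t \<le> C"
proof (cases "t = 1")
  case True
  then show ?thesis using le[of 1 0] by simp
next
  case False
  \<comment> \<open>Adding 1 to the floor makes \<open>s k\<close> strictly larger than t, as the
    right-hand filter demands; it stays at most 1 because t < 1.\<close>
  define j where "j k = nat \<lfloor>t * 2 ^ k\<rfloor> + 1" for k :: nat
  define s where "s k = real (j k) / 2 ^ k" for k
  have jr: "real (j k) = of_int \<lfloor>t * 2 ^ k\<rfloor> + 1" for k
    using t by (simp add: j_def)
  have gt: "t < s k" for k
    using floor_correct[of "t * 2 ^ k"] by (simp add: s_def jr pos_less_divide_eq)
  have less: "s k \<le> t + (1 / 2) ^ k" for k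
    using floor_correct[of "t * 2 ^ k"] by (simp add: s_def jr field_simps)
  have j: "j k \<le> 2 ^ k" for k
  proof -
    have "t * 2 ^ k < 1 * 2 ^ k" using t False by (intro mult_strict_right_mono) auto
    then have "\<lfloor>t * 2 ^ k\<rfloor> < 2 ^ k" by (simp add: floor_less_iff)
    then show ?thesis unfolding j_def using t by (simp add: Suc_le_eq nat_less_iff)
  qed
  have "(\<lambda>k. t + (1 / 2) ^ k) \<longlonglongrightarrow> t + 0"
    by (intro tendsto_intros LIMSEQ_power_zero) simp
  then have "s \<longlonglongrightarrow> t"
    by (intro tendsto_sandwich[OF _ _ tendsto_const, of _ s sequentially "\<lambda>k. t + (1 / 2) ^ k"])
      (auto simp: less less_imp_le[OF gt])
  then have "filterlim s (at_right t) sequentially"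
    using gt by (simp add: filterlim_at less_imp_neq[symmetric])
  moreover have "(f \<longlongrightarrow> f t) (at_right t)" using cont t by (simp add: continuous_within)
  ultimately have "(\<lambda>k. f (s k)) \<longlonglongrightarrow> f t" by (rule filterlim_compose[rotated])
  then show ?thesis using le[OF j] by (intro LIMSEQ_le_const2) (auto simp: s_def)
qed

lemma dyadic_sup_le:
  assumes bdd: "bdd_above (f ` {0..1})" and 0: "f 0 = 0" and p: "0 < p"
  shows "dyadic_sup p f \<le> ennreal ((SUP t\<in>{0..1}. f t) powr p)"
  unfolding dyadic_sup_def
proof (rule SUP_least, rule ennreal_leI, rule powr_mono2)
  fix k :: nat
  have "f (real j / real (2 ^ k)) \<le> (SUP t\<in>{0..1}. f t)" if "j \<in> {0..2 ^ k}" for j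
    using that by (intro cSUP_upper bdd) auto
  then show "grid_max f (2 ^ k) \<le> (SUP t\<in>{0..1}. f t)" unfolding grid_max_def 0 by simp
qed (use p in \<open>auto simp: grid_max_eq_lindley lindley_nonneg\<close>)

text \<open>A finite value bounds the path on every dyadic grid by the p-th root C, and
  right-continuity extends the bound to all of [0, 1]. The same C bounds the true supremum, which
  gives equality.\<close>

lemma dyadic_sup_finite:
  fixes f :: "real \<Rightarrow> real"
  assumes cont: "\<And>t. 0 \<le> t \<Longrightarrow> continuous (at_right t) f" and 0: "f 0 = 0"
    and fin: "dyadic_sup p f < \<infinity>" and p: "0 < p"
  shows "bdd_above (f ` {0..1})"
    and "dyadic_sup p f = ennreal ((SUP t\<in>{0..1}. f t) powr p)"
proof -
  define D where "D = enn2real (dyadic_sup p f)"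
  have D: "dyadic_sup p f = ennreal D" using fin by (simp add: D_def less_top)
  have D0: "0 \<le> D" by (simp add: D_def)
  define C where "C = D powr (1 / p)"
  have nn: "0 \<le> grid_max f n" for n by (simp add: grid_max_eq_lindley lindley_nonneg)
  have gm: "grid_max f (2 ^ k) \<le> C" for k
  proof -
    have "ennreal (grid_max f (2 ^ k) powr p) \<le> ennreal D"
      unfolding D[symmetric] dyadic_sup_def by (rule SUP_upper) simp
    then have "grid_max f (2 ^ k) powr p \<le> D" using D0 by simp
    then have "(grid_max f (2 ^ k) powr p) powr (1 / p) \<le> C"
      unfolding C_def using p by (intro powr_mono2) auto
    then show ?thesis using nn[of "2 ^ k"] p by (simp add: powr_powr)
  qed
  have le: "f t \<le> C" if "t \<in> {0..1}" for t
  proof (rule right_continuous_le_of_dyadic[OF cont _ that])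
    fix k j :: nat assume "j \<le> 2 ^ k"
    then have "f (real j / real (2 ^ k)) - f 0 \<le> grid_max f (2 ^ k)" by (rule grid_max_ge)
    then show "f (real j / 2 ^ k) \<le> C" using gm[of k] 0 by simp
  qed
  then show bdd: "bdd_above (f ` {0..1})" by (rule bdd_aboveI2)
  let ?s = "SUP t\<in>{0..1}. f t"
  have s0: "0 \<le> ?s" using cSUP_upper[OF _ bdd, of 0] 0 by simp
  show "dyadic_sup p f = ennreal (?s powr p)"
  proof (rule antisym)
    show "dyadic_sup p f \<le> ennreal (?s powr p)" by (rule dyadic_sup_le[OF bdd 0 p])
    have "?s \<le> C" using le by (intro cSUP_least) auto
    then have "?s powr p \<le> C powr p" using s0 p by (intro powr_mono2) auto
    also have "\<dots> = D" using D0 p by (simp add: C_def powr_powr)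
    finally show "ennreal (?s powr p) \<le> dyadic_sup p f" unfolding D by (rule ennreal_leI)
  qed
qed

section \<open>Levy processes sampled on grids\<close>

lemma levy_process_measurable: "levy_process M X \<Longrightarrow> 0 \<le> t \<Longrightarrow> X t \<in> borel_measurable M"
  by (simp add: levy_process_def)

lemma levy_process_stationary:
  "levy_process M X \<Longrightarrow> 0 \<le> s \<Longrightarrow> 0 \<le> t \<Longrightarrow>
    distr M borel (\<lambda>\<omega>. X (s + t) \<omega> - X s \<omega>) = distr M borel (X t)"
  unfolding levy_process_def by blast

lemma levy_process_grid:
  fixes X :: "real \<Rightarrow> 'a \<Rightarrow> 'd::euclidean_space"
  assumes X: "levy_process M X" and n: "0 < n"
  shows "prob_space.indep_vars M (\<lambda>_. borel) (\<lambda>i \<omega>. grid_increment (\<lambda>t. X t \<omega> \<bullet> u) n i) {..<n}"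
    and "i < n \<Longrightarrow> distr M borel (\<lambda>\<omega>. grid_increment (\<lambda>t. X t \<omega> \<bullet> u) n i) =
      distr M borel (\<lambda>\<omega>. X (1 / real n) \<omega> \<bullet> u)"
proof -
  interpret prob_space M using X by (simp add: levy_process_def)
  have [measurable]: "X (real k / real m) \<in> borel_measurable M" "X (1 / real m) \<in> borel_measurable M" for k m
    using levy_process_measurable[OF X] by simp_all
  have incr: "\<And>n (\<tau>::nat \<Rightarrow> real). 0 \<le> \<tau> 0 \<Longrightarrow> (\<forall>i<n. \<tau> i < \<tau> (Suc i)) \<Longrightarrow>
      indep_vars (\<lambda>_. borel) (\<lambda>i \<omega>. X (\<tau> (Suc i)) \<omega> - X (\<tau> i) \<omega>) {..<n}"
    using X unfolding levy_process_def by blast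
  have "indep_vars (\<lambda>_. borel) (\<lambda>i \<omega>. X (real (Suc i) / real n) \<omega> - X (real i / real n) \<omega>) {..<n}"
    using n by (intro incr[of "\<lambda>i. real i / real n"]) (auto intro!: divide_strict_right_mono)
  then have "indep_vars (\<lambda>_. borel)
      (\<lambda>i \<omega>. X (real (Suc (n - Suc i)) / real n) \<omega> - X (real (n - Suc i) / real n) \<omega>) {..<n}"
    by (rule indep_vars_reindex_on[where f = "\<lambda>i. n - Suc i"]) (auto intro!: inj_onI)
  then have "indep_vars (\<lambda>_. borel) (\<lambda>i \<omega>. (X (real (Suc (n - Suc i)) / real n) \<omega> -
      X (real (n - Suc i) / real n) \<omega>) \<bullet> u) {..<n}"
    by (rule indep_vars_compose2) simp
  then show "indep_vars (\<lambda>_. borel) (\<lambda>i \<omega>. grid_increment (\<lambda>t. X t \<omega> \<bullet> u) n i) {..<n}"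
    by (rule indep_vars_cong[THEN iffD1, rotated -1])
      (auto simp: grid_increment_def inner_diff_left Suc_diff_Suc simp del: of_nat_Suc)
  assume i: "i < n"
  have "real (n - Suc i) / real n + 1 / real n = real (n - i) / real n"
    using i by (simp add: add_divide_distrib[symmetric] of_nat_diff)
  then have "distr M borel (\<lambda>\<omega>. X (real (n - i) / real n) \<omega> - X (real (n - Suc i) / real n) \<omega>) =
      distr M borel (X (1 / real n))"
    using levy_process_stationary[OF X, of "real (n - Suc i) / real n" "1 / real n"] by simp
  from arg_cong[OF this, of "\<lambda>D. distr D borel (\<lambda>x. x \<bullet> u)"]
  show "distr M borel (\<lambda>\<omega>. grid_increment (\<lambda>t. X t \<omega> \<bullet> u) n i) = distr M borel (\<lambda>\<omega>. X (1 / real n) \<omega> \<bullet> u)"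
    by (simp add: distr_distr comp_def grid_increment_def inner_diff_left)
qed

lemma measurable_grid_max:
  assumes "\<And>t. 0 \<le> t \<Longrightarrow> (\<lambda>\<omega>. f \<omega> t) \<in> borel_measurable M"
  shows "(\<lambda>\<omega>. grid_max (f \<omega>) n) \<in> borel_measurable M"
proof -
  have [measurable]: "(\<lambda>\<omega>. f \<omega> (real k / real m)) \<in> borel_measurable M" for k m
    using assms by simp
  show ?thesis unfolding grid_max_eq_lindley grid_increment_def[abs_def] by measurable
qed

lemma measurable_dyadic_sup:
  assumes "\<And>t. 0 \<le> t \<Longrightarrow> (\<lambda>\<omega>. f \<omega> t) \<in> borel_measurable M"
  shows "(\<lambda>\<omega>. dyadic_sup p (f \<omega>)) \<in> borel_measurable M"
  using measurable_grid_max[of f M] assms unfolding dyadic_sup_def by measurable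

lemma nn_integral_dyadic_sup:
  assumes "\<And>t. 0 \<le> t \<Longrightarrow> (\<lambda>\<omega>. f \<omega> t) \<in> borel_measurable M" and p: "0 < p"
  shows "(\<integral>\<^sup>+\<omega>. dyadic_sup p (f \<omega>) \<partial>M) = (SUP k. \<integral>\<^sup>+\<omega>. ennreal (grid_max (f \<omega>) (2 ^ k) powr p) \<partial>M)"
  unfolding dyadic_sup_def
proof (rule nn_integral_monotone_convergence_SUP)
  show "incseq (\<lambda>k \<omega>. ennreal (grid_max (f \<omega>) (2 ^ k) powr p))"
    using incseq_grid_max[OF p] by (simp add: incseq_def le_fun_def)
qed (use measurable_grid_max[of f M] assms in measurable)

text \<open>The law of a grid maximum depends only on the laws of independent increments, so the two
  processes agree grid by grid up to the factor c; monotone convergence passes to the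
  suprema.\<close>

lemma nn_integral_dyadic_sup_scaled:
  fixes X :: "real \<Rightarrow> 'a \<Rightarrow> 'd::euclidean_space" and Y :: "real \<Rightarrow> 'b \<Rightarrow> real"
  assumes X: "levy_process M X" and Y: "levy_process N Y" and c: "0 \<le> c" and p: "0 < p"
    and eq: "\<And>t. 0 \<le> t \<Longrightarrow> distr M borel (\<lambda>\<omega>. X t \<omega> \<bullet> u) = distr N borel (\<lambda>\<omega>. c * Y t \<omega>)"
  shows "(\<integral>\<^sup>+\<omega>. dyadic_sup p (\<lambda>t. X t \<omega> \<bullet> u) \<partial>M) = ennreal (c powr p) * (\<integral>\<^sup>+\<omega>. dyadic_sup p (\<lambda>t. Y t \<omega>) \<partial>N)"
proof -
  interpret M: prob_space M using X by (simp add: levy_process_def)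
  interpret N: prob_space N using Y by (simp add: levy_process_def)
  have mX: "(\<lambda>\<omega>. X t \<omega> \<bullet> u) \<in> borel_measurable M" if "0 \<le> t" for t
    using levy_process_measurable[OF X that] by measurable
  have mY: "Y t \<in> borel_measurable N" if "0 \<le> t" for t
    using levy_process_measurable[OF Y that] .
  have "(\<integral>\<^sup>+\<omega>. ennreal (grid_max (\<lambda>t. X t \<omega> \<bullet> u) n powr p) \<partial>M) =
      ennreal (c powr p) * (\<integral>\<^sup>+\<omega>. ennreal (grid_max (\<lambda>t. Y t \<omega>) n powr p) \<partial>N)" if n: "0 < n" for n
  proof -
    note gX = levy_process_grid[OF X n, where u = u] and gY = levy_process_grid[OF Y n, where u = 1, simplified]
    have mg: "(\<lambda>\<omega>. grid_increment (\<lambda>t. Y t \<omega>) n i) \<in> borel_measurable N" for i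
      unfolding grid_increment_def using mY by (intro borel_measurable_diff) auto
    have "distr N borel (\<lambda>\<omega>. c * grid_increment (\<lambda>t. Y t \<omega>) n i) = distr N borel (\<lambda>\<omega>. c * Y (1 / real n) \<omega>)"
      if "i < n" for i
      using arg_cong[OF gY(2)[OF that], of "\<lambda>D. distr D borel (\<lambda>x. c * x)"] mg mY[of "1 / real n"]
      by (simp add: distr_distr comp_def)
    then have d: "distr M borel (\<lambda>\<omega>. grid_increment (\<lambda>t. X t \<omega> \<bullet> u) n i) =
        distr N borel (\<lambda>\<omega>. c * grid_increment (\<lambda>t. Y t \<omega>) n i)" if "i < n" for i
      using that gX(2)[of i] eq[of "1 / real n"] by simp
    have i: "N.indep_vars (\<lambda>_. borel) (\<lambda>i \<omega>. c * grid_increment (\<lambda>t. Y t \<omega>) n i) {..<n}"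
      by (rule N.indep_vars_compose2[OF gY(1)]) simp
    have "distr M borel (\<lambda>\<omega>. grid_max (\<lambda>t. X t \<omega> \<bullet> u) n) =
        distr N borel (\<lambda>\<omega>. c * grid_max (\<lambda>t. Y t \<omega>) n)"
      using M.distr_lindley_eq[OF N.prob_space_axioms gX(1) i d] c
      by (simp add: grid_max_eq_lindley lindley_mult)
    from arg_cong[OF this, of "\<lambda>D. \<integral>\<^sup>+x. ennreal (x powr p) \<partial>D"]
    have "(\<integral>\<^sup>+\<omega>. ennreal (grid_max (\<lambda>t. X t \<omega> \<bullet> u) n powr p) \<partial>M) =
        (\<integral>\<^sup>+\<omega>. ennreal ((c * grid_max (\<lambda>t. Y t \<omega>) n) powr p) \<partial>N)"
      using measurable_grid_max[of "\<lambda>\<omega> t. X t \<omega> \<bullet> u" M n] measurable_grid_max[of "\<lambda>\<omega> t. Y t \<omega>" N n] mX mY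
      by (simp add: nn_integral_distr)
    also have "\<dots> = (\<integral>\<^sup>+\<omega>. ennreal (c powr p) * ennreal (grid_max (\<lambda>t. Y t \<omega>) n powr p) \<partial>N)"
      using c by (simp add: powr_mult grid_max_eq_lindley lindley_nonneg ennreal_mult)
    also have "\<dots> = ennreal (c powr p) * (\<integral>\<^sup>+\<omega>. ennreal (grid_max (\<lambda>t. Y t \<omega>) n powr p) \<partial>N)"
      using measurable_grid_max[of "\<lambda>\<omega> t. Y t \<omega>" N n] mY by (intro nn_integral_cmult) simp
    finally show ?thesis .
  qed
  then show ?thesis
    using mX mY p by (simp add: nn_integral_dyadic_sup SUP_mult_left_ennreal)
qed

lemma scale_parameter_one_char:
  assumes "levy_process N R" "scale_parameter_one \<alpha> N R" "0 \<le> t"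
  shows "char (distr N borel (\<lambda>\<omega>. c * R t \<omega>)) s = complex_of_real (exp (- t * \<bar>s * c\<bar> powr \<alpha>))"
proof -
  have [measurable]: "R t \<in> borel_measurable N" using assms levy_process_measurable by blast
  have "char (distr N borel (\<lambda>\<omega>. c * R t \<omega>)) s = (CLINT \<omega>|N. iexp ((s * c) * R t \<omega>))"
    unfolding char_def by (subst integral_distr) (simp_all add: mult_ac)
  also have "\<dots> = complex_of_real (exp (- t * \<bar>s * c\<bar> powr \<alpha>))"
    using assms(2,3) unfolding scale_parameter_one_def by blast
  finally show ?thesis .
qed

text \<open>The increments telescope to R 1 - R 0, so the maximal inequality bounds every grid by
  the same moment of R 1.\<close>

lemma nn_integral_dyadic_sup_stable_finite:
  fixes R :: "real \<Rightarrow> 'b \<Rightarrow> real"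
  assumes R: "levy_process N R" "scale_parameter_one \<alpha> N R" and p: "0 < p" "p < \<alpha>"
  shows "(\<integral>\<^sup>+\<omega>. dyadic_sup p (\<lambda>t. R t \<omega>) \<partial>N) < \<infinity>"
proof -
  interpret prob_space N using R by (simp add: levy_process_def)
  have m: "R t \<in> borel_measurable N" if "0 \<le> t" for t
    using levy_process_measurable[OF R(1) that] .
  have sym: "distr (distr N borel (R t)) borel uminus = distr N borel (R t)" if t: "0 \<le> t" for t
  proof -
    have "distr N borel (\<lambda>\<omega>. - 1 * R t \<omega>) = distr N borel (\<lambda>\<omega>. 1 * R t \<omega>)"
      using m[OF t] scale_parameter_one_char[OF R t, of "- 1"] scale_parameter_one_char[OF R t, of 1]
      by (intro Levy_uniqueness real_distribution_distr) (auto simp: fun_eq_iff)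
    then show ?thesis using m[OF t] by (simp add: distr_distr comp_def)
  qed
  have "(\<integral>\<^sup>+\<omega>. ennreal (grid_max (\<lambda>t. R t \<omega>) n powr p) \<partial>N) \<le> 2 * (\<integral>\<^sup>+x. ennreal (\<bar>x\<bar> powr p) \<partial>distr N borel (R 1))"
    if n: "0 < n" for n
  proof -
    note g = levy_process_grid[OF R(1) n, where u = 1, simplified]
    have tele: "(\<Sum>i<n. grid_increment f n i) = f 1 - f 0" for f
    proof -
      have "(\<Sum>i<j. grid_increment f n i) = f 1 - f (real (n - j) / real n)" if "j \<le> n" for j
        using that by (induction j) (use n in \<open>auto simp: grid_increment_def\<close>)
      from this[of n] show ?thesis by simp
    qed
    \<comment> \<open>Stationarity started at time 0 replaces R 1 - R 0 by R 1 in law.\<close>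
    have "distr N borel (\<lambda>\<omega>. R 1 \<omega> - R 0 \<omega>) = distr N borel (R 1)"
      using R(1) levy_process_stationary[of N R 0 1] by simp
    then have "(\<integral>\<^sup>+x. ennreal (\<bar>x\<bar> powr p) \<partial>distr N borel (\<lambda>\<omega>. R 1 \<omega> - R 0 \<omega>)) =
        (\<integral>\<^sup>+x. ennreal (\<bar>x\<bar> powr p) \<partial>distr N borel (R 1))" by simp
    then have last: "(\<integral>\<^sup>+\<omega>. ennreal (\<bar>R 1 \<omega> - R 0 \<omega>\<bar> powr p) \<partial>N) =
        (\<integral>\<^sup>+x. ennreal (\<bar>x\<bar> powr p) \<partial>distr N borel (R 1))"
      using m[of 0] m[of 1] by (subst (asm) (1) nn_integral_distr) auto
    have "distr (distr N borel (\<lambda>\<omega>. grid_increment (\<lambda>t. R t \<omega>) n i)) borel uminus =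
        distr N borel (\<lambda>\<omega>. grid_increment (\<lambda>t. R t \<omega>) n i)" if "i < n" for i
      unfolding g(2)[OF that] by (rule sym) simp
    from nn_integral_lindley_powr_le[OF g(1) this p(1)] show ?thesis
      by (simp add: grid_max_eq_lindley[symmetric] tele last)
  qed
  then have "(\<integral>\<^sup>+\<omega>. dyadic_sup p (\<lambda>t. R t \<omega>) \<partial>N) \<le> 2 * (\<integral>\<^sup>+x. ennreal (\<bar>x\<bar> powr p) \<partial>distr N borel (R 1))"
    using m p(1) by (subst nn_integral_dyadic_sup) (auto intro!: SUP_least)
  also have "\<dots> < \<infinity>"
  proof -
    have "(\<integral>\<^sup>+x. ennreal (\<bar>x\<bar> powr p) \<partial>distr N borel (R 1)) < \<infinity>"
      using m[of 1] scale_parameter_one_char[OF R, of 1 1] p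
      by (intro stable_moment_finite[of _ \<alpha>]) auto
    then show ?thesis by (simp add: ennreal_mult_less_top)
  qed
  finally show ?thesis .
qed

text \<open>Both characteristic functions equal exp (- t |s h(K, u)|^\<alpha>), so Levy's uniqueness
  theorem applies. Homogeneity of h(K, .) covers s \<ge> 0; negative s needs h(K, .) to be
  even.\<close>

lemma associated_zonoid_marginal:
  fixes X :: "real \<Rightarrow> 'a \<Rightarrow> 'd::euclidean_space"
  assumes X: "levy_process M X" "associated_zonoid \<alpha> M X K"
    and R: "levy_process N R" "scale_parameter_one \<alpha> N R" and \<alpha>: "0 < \<alpha>" and t: "0 \<le> t"
  shows "distr M borel (\<lambda>\<omega>. X t \<omega> \<bullet> u) = distr N borel (\<lambda>\<omega>. support_fun K u * R t \<omega>)"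
proof -
  interpret M: prob_space M using X by (simp add: levy_process_def)
  interpret N: prob_space N using R by (simp add: levy_process_def)
  let ?h = "support_fun K"
  have K: "compact K" "K \<noteq> {}" "0 \<in> K" using X(2) by (auto simp: associated_zonoid_def convex_body_def)
  have cf: "(CLINT \<omega>|M. iexp (X t \<omega> \<bullet> v)) = complex_of_real (exp (- t * ?h v powr \<alpha>))" if "0 \<le> t" for t v
    using X(2) that unfolding associated_zonoid_def by blast
  have h: "0 \<le> ?h v" for v by (rule support_fun_nonneg[OF K(1,3)])
  \<comment> \<open>Replacing v by -v conjugates the characteristic function, which is real, so the
    two exponents coincide.\<close>
  have even: "?h (- v) = ?h v" for v
  proof -
    have "(CLINT \<omega>|M. iexp (X 1 \<omega> \<bullet> (- v))) = cnj (CLINT \<omega>|M. iexp (X 1 \<omega> \<bullet> v))"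
      by (rule trans[OF Bochner_Integration.integral_cong Bochner_Integration.integral_cnj]) (simp_all add: exp_cnj)
    then have "?h (- v) powr \<alpha> = ?h v powr \<alpha>" unfolding cf[OF zero_le_one] by simp
    then have "(?h (- v) powr \<alpha>) powr (1 / \<alpha>) = (?h v powr \<alpha>) powr (1 / \<alpha>)" by simp
    then show ?thesis using h \<alpha> by (simp add: powr_powr)
  qed
  have habs: "?h (s *\<^sub>R u) = \<bar>s * ?h u\<bar>" for s
    using support_fun_scaleR[OF K(1,2), of "\<bar>s\<bar>" u] even[of "\<bar>s\<bar> *\<^sub>R u"] h[of u]
    by (cases "0 \<le> s") (auto simp: abs_mult)
  have [measurable]: "X t \<in> borel_measurable M" "R t \<in> borel_measurable N"
    using levy_process_measurable X R t by blast+
  have "char (distr M borel (\<lambda>\<omega>. X t \<omega> \<bullet> u)) s = (CLINT \<omega>|M. iexp (X t \<omega> \<bullet> (s *\<^sub>R u)))" for s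
    unfolding char_def by (subst integral_distr) simp_all
  then have "char (distr M borel (\<lambda>\<omega>. X t \<omega> \<bullet> u)) s = complex_of_real (exp (- t * \<bar>s * ?h u\<bar> powr \<alpha>))" for s
    unfolding cf[OF t] habs .
  then show ?thesis
    by (intro Levy_uniqueness M.real_distribution_distr N.real_distribution_distr)
      (auto simp: fun_eq_iff scale_parameter_one_char[OF R t])
qed

section \<open>The support function of the path hull\<close>

lemma support_fun_closure_convex_hull:
  fixes T :: "'d::euclidean_space set"
  assumes T: "bounded T" "T \<noteq> {}"
  shows "convex_body (closure (convex hull T))"
    and "support_fun (closure (convex hull T)) u = (SUP x\<in>T. x \<bullet> u)"
proof -
  let ?S = "closure (convex hull T)"
  have TS: "T \<subseteq> ?S" using closure_subset hull_subset by (metis subset_trans)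
  show S: "convex_body ?S"
    using T TS unfolding convex_body_def
    by (auto simp: bounded_convex_hull intro!: convex_closure convex_convex_hull)
  then have cS: "compact ?S" "?S \<noteq> {}" by (auto simp: convex_body_def)
  have bdd: "bdd_above ((\<lambda>x. x \<bullet> u) ` T)"
    using compact_bdd_above_inner[OF cS(1)] TS by (meson bdd_above_mono image_mono)
  show "support_fun ?S u = (SUP x\<in>T. x \<bullet> u)"
  proof (rule antisym)
    have "T \<subseteq> {z. u \<bullet> z \<le> (SUP x\<in>T. x \<bullet> u)}"
      using cSUP_upper[OF _ bdd] by (auto simp: inner_commute)
    then have "?S \<subseteq> {z. u \<bullet> z \<le> (SUP x\<in>T. x \<bullet> u)}"
      by (intro closure_minimal hull_minimal closed_halfspace_le convex_halfspace_le)
    then show "support_fun ?S u \<le> (SUP x\<in>T. x \<bullet> u)"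
      using cS(2) by (intro support_fun_least) (auto simp: inner_commute)
    show "(SUP x\<in>T. x \<bullet> u) \<le> support_fun ?S u"
      using T TS cS by (intro cSUP_least inner_le_support_fun) auto
  qed
qed

text \<open>Finiteness in the 2d coordinate directions already bounds the path. The conclusion then
  holds for all u at the same \<omega>, so the exceptional null set does not depend on u.\<close>

lemma path_hull_support_fun:
  fixes X :: "real \<Rightarrow> 'a \<Rightarrow> 'd::euclidean_space"
  assumes cont: "cadlag (\<lambda>t. X t \<omega>)" and 0: "X 0 \<omega> = 0" and p: "0 < p"
    and fin: "\<And>e. e \<in> Basis \<Longrightarrow> dyadic_sup p (\<lambda>t. X t \<omega> \<bullet> e) < \<infinity>"
      "\<And>e. e \<in> Basis \<Longrightarrow> dyadic_sup p (\<lambda>t. X t \<omega> \<bullet> (- e)) < \<infinity>"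
  shows "convex_body (path_hull X \<omega>)" "0 \<in> path_hull X \<omega>"
    and "ennreal (support_fun (path_hull X \<omega>) u powr p) = dyadic_sup p (\<lambda>t. X t \<omega> \<bullet> u)"
proof -
  let ?T = "(\<lambda>t. X t \<omega>) ` {0..1}"
  have rc: "continuous (at_right t) (\<lambda>t. X t \<omega> \<bullet> v)" if "0 \<le> t" for t v
    using cont that unfolding cadlag_def by (intro continuous_inner continuous_const) auto
  have "\<exists>B. \<forall>x\<in>?T. \<bar>x \<bullet> e\<bar> \<le> B" if e: "e \<in> Basis" for e
  proof -
    have "bdd_above ((\<lambda>t. X t \<omega> \<bullet> e) ` {0..1})" "bdd_above ((\<lambda>t. X t \<omega> \<bullet> (- e)) ` {0..1})"
      using dyadic_sup_finite(1)[OF rc _ fin(1)[OF e] p] dyadic_sup_finite(1)[OF rc _ fin(2)[OF e] p] 0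
      by simp_all
    then obtain a b where "\<And>t. t \<in> {0..1} \<Longrightarrow> X t \<omega> \<bullet> e \<le> a" "\<And>t. t \<in> {0..1} \<Longrightarrow> X t \<omega> \<bullet> (- e) \<le> b"
      unfolding bdd_above_def by (metis imageI)
    then have "\<forall>x\<in>?T. \<bar>x \<bullet> e\<bar> \<le> max a b" by (fastforce simp: abs_le_iff)
    then show ?thesis ..
  qed
  then obtain B where B: "\<And>e x. e \<in> Basis \<Longrightarrow> x \<in> ?T \<Longrightarrow> \<bar>x \<bullet> e\<bar> \<le> B e" by metis
  have "norm x \<le> (\<Sum>e\<in>Basis. B e)" if "x \<in> ?T" for x
    using norm_le_l1[of x] sum_mono[of Basis "\<lambda>e. \<bar>x \<bullet> e\<bar>" B] B[OF _ that] by (meson order_trans)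
  then have "bounded ?T" unfolding bounded_iff by blast
  note S = support_fun_closure_convex_hull[OF this, folded path_hull_def]
  show "convex_body (path_hull X \<omega>)" by (rule S(1)) simp
  show "0 \<in> path_hull X \<omega>"
  proof -
    have "0 \<in> ?T" using 0 by (intro image_eqI[of _ _ 0]) auto
    then show ?thesis
      unfolding path_hull_def using closure_subset hull_subset by (metis subsetD)
  qed
  have sup: "support_fun (path_hull X \<omega>) u = (SUP t\<in>{0..1}. X t \<omega> \<bullet> u)"
    by (subst S(2)) (simp_all add: image_image)
  have bdd: "bdd_above ((\<lambda>t. X t \<omega> \<bullet> u) ` {0..1})"
    using bounded_imp_bdd_above[OF bounded_linear_image[OF \<open>bounded ?T\<close> bounded_linear_inner_left]]
    by (simp add: image_image)
  have "dyadic_sup p (\<lambda>t. X t \<omega> \<bullet> u) \<le> ennreal ((SUP t\<in>{0..1}. X t \<omega> \<bullet> u) powr p)"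
    by (rule dyadic_sup_le[OF bdd _ p]) (simp add: 0)
  then have "dyadic_sup p (\<lambda>t. X t \<omega> \<bullet> u) < \<infinity>" by (rule le_less_trans) simp
  from dyadic_sup_finite(2)[OF rc _ this p] 0
  show "ennreal (support_fun (path_hull X \<omega>) u powr p) = dyadic_sup p (\<lambda>t. X t \<omega> \<bullet> u)"
    by (simp add: sup)
qed

section \<open>Integration over the completed space\<close>

lemma borel_measurable_completion_AE:
  fixes f g :: "'a \<Rightarrow> real"
  assumes g: "g \<in> borel_measurable M" and eq: "AE x in M. f x = g x"
  shows "f \<in> borel_measurable (completion M)"
proof (rule measurableI)
  fix A :: "real set" assume A: "A \<in> sets borel"
  show "f -` A \<inter> space (completion M) \<in> sets (completion M)"
  proof (rule completion.in_sets_AE)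
    show "g -` A \<inter> space M \<in> sets (completion M)"
      using measurable_sets[OF g A] by simp
    show "AE x in completion M. x \<in> g -` A \<inter> space M \<longleftrightarrow> x \<in> f -` A \<inter> space (completion M)"
      using AE_completion[OF eq] by eventually_elim auto
  qed simp
qed simp

text \<open>V is not known to be measurable on M; its almost sure agreement with a measurable
  extended-real G transfers measurability to the completion and the value of the integral back to
  M.\<close>

lemma integral_completion_eqI:
  fixes V :: "'a \<Rightarrow> real"
  assumes G: "G \<in> borel_measurable M" and eq: "AE \<omega> in M. ennreal (V \<omega>) = G \<omega>"
    and nonneg: "AE \<omega> in M. 0 \<le> V \<omega>" and fin: "(\<integral>\<^sup>+\<omega>. G \<omega> \<partial>M) < \<infinity>"
  shows "integrable (completion M) V"
    and "ennreal (\<integral>\<omega>. V \<omega> \<partial>completion M) = (\<integral>\<^sup>+\<omega>. G \<omega> \<partial>M)"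
proof -
  have "AE \<omega> in M. V \<omega> = enn2real (G \<omega>)"
    using eq nonneg by eventually_elim (metis enn2real_ennreal)
  then have V: "V \<in> borel_measurable (completion M)"
    by (rule borel_measurable_completion_AE[rotated]) (use G in measurable)
  have nn: "(\<integral>\<^sup>+\<omega>. ennreal (V \<omega>) \<partial>completion M) = (\<integral>\<^sup>+\<omega>. G \<omega> \<partial>M)"
    unfolding nn_integral_completion by (rule nn_integral_cong_AE[OF eq])
  show int: "integrable (completion M) V"
    using V nn fin AE_completion[OF nonneg] by (intro integrableI_nonneg) auto
  show "ennreal (\<integral>\<omega>. V \<omega> \<partial>completion M) = (\<integral>\<^sup>+\<omega>. G \<omega> \<partial>M)"
    using nn_integral_eq_integral[OF int AE_completion[OF nonneg]] nn by simp
qed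

section \<open>Expected mixed volume of the path hull\<close>

theorem theorem4p1:
  fixes L K :: "'d::euclidean_space set"
    and M :: "'a measure" and X :: "real \<Rightarrow> 'a \<Rightarrow> 'd"
    and N :: "'b measure" and R :: "real \<Rightarrow> 'b \<Rightarrow> real"
    and \<alpha> p :: real
  assumes "convex_body L" and "0 \<in> interior L"
    and "1 < \<alpha>" and "\<alpha> < 2"
    and "symmetric_stable_levy_process \<alpha> M X"
    and "\<And>u t. u \<noteq> 0 \<Longrightarrow> 0 < t \<Longrightarrow> nondegenerate M (\<lambda>\<omega>. X t \<omega> \<bullet> u)"
    and "associated_zonoid \<alpha> M X K"
    and "symmetric_stable_levy_process \<alpha> N R" and "scale_parameter_one \<alpha> N R"
    and "1 \<le> p" and "p < \<alpha>"
  shows "integrable (completion M) (\<lambda>\<omega>. Lp_mixed_volume p L (path_hull X \<omega>)) \<and>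
    integrable (completion N) (\<lambda>\<omega>. (SUP t\<in>{0..1}. R t \<omega>) powr p) \<and>
    (\<integral>\<omega>. Lp_mixed_volume p L (path_hull X \<omega>) \<partial>completion M) =
      (\<integral>\<omega>. (SUP t\<in>{0..1}. R t \<omega>) powr p \<partial>completion N) * Lp_mixed_volume p L K"
proof -
  interpret body_around_origin L by (rule body_around_origin.intro) fact+
  have X: "levy_process M X" and R: "levy_process N R" "scale_parameter_one \<alpha> N R"
    using assms by (simp_all add: symmetric_stable_levy_process_def)
  have p: "0 < p" "1 \<le> p" "p < \<alpha>" and \<alpha>: "0 < \<alpha>" using assms by auto
  have K: "convex_body K" "0 \<in> K" using \<open>associated_zonoid \<alpha> M X K\<close> by (auto simp: associated_zonoid_def)
  interpret M: prob_space M using X by (simp add: levy_process_def)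
  interpret \<mu>: finite_measure surface_measure by (rule finite_measure_surface_measure)
  interpret M\<mu>: pair_sigma_finite M surface_measure ..
  let ?Z = "path_hull X" and ?\<mu> = surface_measure
  define H where "H = (\<lambda>\<omega> v. dyadic_sup p (\<lambda>t. X t \<omega> \<bullet> v))"
  define C where "C = (\<integral>\<^sup>+\<omega>. dyadic_sup p (\<lambda>t. R t \<omega>) \<partial>N)"
  have C: "C < \<infinity>" unfolding C_def by (rule nn_integral_dyadic_sup_stable_finite[OF R p(1,3)])
  \<comment> \<open>The comparison of processes is used with scale c = h(K, v).\<close>
  have EH: "(\<integral>\<^sup>+\<omega>. H \<omega> v \<partial>M) = ennreal (support_fun K v powr p) * C" for v
    unfolding H_def C_def
    using associated_zonoid_marginal[OF X assms(7) R \<alpha>] support_fun_nonneg[of K v] K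
    by (intro nn_integral_dyadic_sup_scaled X R p) (auto simp: convex_body_def)

  have mH: "(\<lambda>\<omega>. H \<omega> v) \<in> borel_measurable M" for v
    unfolding H_def using levy_process_measurable[OF X] by (intro measurable_dyadic_sup borel_measurable_inner) auto
  \<comment> \<open>Tonelli's theorem needs joint measurability. It holds for the dyadic suprema as
    countable suprema of jointly measurable functions, and the hull enters only through almost sure
    equality with them.\<close>
  have mH2: "(\<lambda>(\<omega>, v). H \<omega> v) \<in> borel_measurable (M \<Otimes>\<^sub>M ?\<mu>)"
  proof -
    have "(\<lambda>z. dyadic_sup p (\<lambda>t. X t (fst z) \<bullet> snd z)) \<in> borel_measurable (M \<Otimes>\<^sub>M ?\<mu>)"
    proof (rule measurable_dyadic_sup)
      fix t :: real assume "0 \<le> t"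
      then have [measurable]: "X t \<in> borel_measurable M" by (rule levy_process_measurable[OF X])
      have [measurable]: "snd \<in> measurable (M \<Otimes>\<^sub>M ?\<mu>) borel"
        using measurable_snd[of M ?\<mu>] by (simp add: measurable_cong_sets[OF refl sets_surface_measure])
      show "(\<lambda>z. X t (fst z) \<bullet> snd z) \<in> borel_measurable (M \<Otimes>\<^sub>M ?\<mu>)" by measurable
    qed
    then show ?thesis by (simp add: H_def case_prod_beta)
  qed

  have "AE \<omega> in M. H \<omega> v < \<infinity>" for v
    using nn_integral_PInf_AE[OF mH, of v] EH[of v] C by (simp add: ennreal_mult_eq_top_iff less_top)
  then have "AE \<omega> in M. \<forall>e\<in>Basis. H \<omega> e < \<infinity> \<and> H \<omega> (- e) < \<infinity>"
    by (intro AE_ball_countable[THEN iffD2] ballI AE_conjI countable_finite finite_Basis)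
  moreover have "AE \<omega> in M. X 0 \<omega> = 0" "AE \<omega> in M. cadlag (\<lambda>t. X t \<omega>)"
    using X by (simp_all add: levy_process_def)
  ultimately have hull: "AE \<omega> in M. convex_body (?Z \<omega>) \<and> 0 \<in> ?Z \<omega> \<and>
      (\<forall>v. ennreal (support_fun (?Z \<omega>) v powr p) = H \<omega> v)"
  proof eventually_elim
    case (elim \<omega>)
    then show ?case
      using path_hull_support_fun[of X \<omega> p] p(1) by (auto simp: H_def)
  qed
  have V: "AE \<omega> in M. 0 \<le> Lp_mixed_volume p L (?Z \<omega>) \<and>
      ennreal (Lp_mixed_volume p L (?Z \<omega>)) = (\<integral>\<^sup>+v. H \<omega> v \<partial>?\<mu>)"
    using hull
  proof eventually_elim
    case (elim \<omega>)
    then have Z: "convex_body (?Z \<omega>)" "0 \<in> ?Z \<omega>"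
      "\<And>v. ennreal (support_fun (?Z \<omega>) v powr p) = H \<omega> v" by auto
    have int: "integrable ?\<mu> (\<lambda>v. support_fun (?Z \<omega>) v powr p)"
      by (rule integrable_support_fun_powr[OF Z(1,2) p(2)])
    have "(\<integral>\<^sup>+v. H \<omega> v \<partial>?\<mu>) = (\<integral>\<^sup>+v. ennreal (support_fun (?Z \<omega>) v powr p) \<partial>?\<mu>)"
      by (simp add: Z(3))
    also have "\<dots> = ennreal (Lp_mixed_volume p L (?Z \<omega>))"
      unfolding Lp_mixed_volume_eq[OF Z(1,2) p(2)] using int by (rule nn_integral_eq_integral) simp
    finally show ?case by (simp add: Lp_mixed_volume_eq[OF Z(1,2) p(2)])
  qed
  have VK: "0 \<le> Lp_mixed_volume p L K" by (simp add: Lp_mixed_volume_eq[OF K p(2)])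
  have mG: "(\<lambda>\<omega>. \<integral>\<^sup>+v. H \<omega> v \<partial>?\<mu>) \<in> borel_measurable M"
    using \<mu>.borel_measurable_nn_integral_fst[OF mH2] by simp
  \<comment> \<open>After exchanging the integrals the constant C leaves the integral over
    directions, and what remains is the mixed volume with K.\<close>
  have EG: "(\<integral>\<^sup>+\<omega>. \<integral>\<^sup>+v. H \<omega> v \<partial>?\<mu> \<partial>M) = ennreal (Lp_mixed_volume p L K) * C"
  proof -
    have "(\<integral>\<^sup>+\<omega>. \<integral>\<^sup>+v. H \<omega> v \<partial>?\<mu> \<partial>M) = (\<integral>\<^sup>+v. \<integral>\<^sup>+\<omega>. H \<omega> v \<partial>M \<partial>?\<mu>)"
      by (rule M\<mu>.Fubini'[OF mH2, symmetric])
    also have "\<dots> = (\<integral>\<^sup>+v. ennreal (support_fun K v powr p) * C \<partial>?\<mu>)" by (simp add: EH)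
    also have "\<dots> = (\<integral>\<^sup>+v. ennreal (support_fun K v powr p) \<partial>?\<mu>) * C"
      using integrable_support_fun_powr[OF K p(2)] by (intro nn_integral_multc) auto
    also have "(\<integral>\<^sup>+v. ennreal (support_fun K v powr p) \<partial>?\<mu>) = ennreal (Lp_mixed_volume p L K)"
      unfolding Lp_mixed_volume_eq[OF K p(2)]
      using integrable_support_fun_powr[OF K p(2)] by (intro nn_integral_eq_integral) auto
    finally show ?thesis .
  qed
  have mR: "(\<lambda>\<omega>. dyadic_sup p (\<lambda>t. R t \<omega>)) \<in> borel_measurable N"
    using levy_process_measurable[OF R(1)] by (intro measurable_dyadic_sup) auto
  have "AE \<omega> in N. dyadic_sup p (\<lambda>t. R t \<omega>) < \<infinity>"
    using nn_integral_PInf_AE[OF mR] C by (simp add: C_def less_top)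
  moreover have "AE \<omega> in N. R 0 \<omega> = 0" "AE \<omega> in N. cadlag (\<lambda>t. R t \<omega>)"
    using R by (simp_all add: levy_process_def)
  ultimately have sup: "AE \<omega> in N. ennreal ((SUP t\<in>{0..1}. R t \<omega>) powr p) = dyadic_sup p (\<lambda>t. R t \<omega>)"
  proof eventually_elim
    case (elim \<omega>)
    then show ?case by (subst dyadic_sup_finite(2)) (auto simp: cadlag_def p)
  qed
  have nonneg: "AE \<omega> in N. 0 \<le> (SUP t\<in>{0..1}. R t \<omega>) powr p" by simp
  note IR = integral_completion_eqI[OF mR sup nonneg, folded C_def, OF C]
  have "AE \<omega> in M. ennreal (Lp_mixed_volume p L (?Z \<omega>)) = (\<integral>\<^sup>+v. H \<omega> v \<partial>?\<mu>)"
    "AE \<omega> in M. 0 \<le> Lp_mixed_volume p L (?Z \<omega>)"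
    using V by auto
  note IX = integral_completion_eqI[OF mG this, unfolded EG]
  have fin: "ennreal (Lp_mixed_volume p L K) * C < \<infinity>" using C by (simp add: ennreal_mult_less_top)
  have "ennreal (\<integral>\<omega>. Lp_mixed_volume p L (?Z \<omega>) \<partial>completion M) =
      ennreal ((\<integral>\<omega>. (SUP t\<in>{0..1}. R t \<omega>) powr p \<partial>completion N) * Lp_mixed_volume p L K)"
    using IX(2)[OF fin] IR(2) VK by (simp add: ennreal_mult' mult.commute)
  \<comment> \<open>Both real sides must be nonnegative before the identity between their
    extended-real images can be pulled back.\<close>
  moreover have "0 \<le> (\<integral>\<omega>. Lp_mixed_volume p L (?Z \<omega>) \<partial>completion M)"
    using V by (intro integral_nonneg_AE AE_completion) auto
  moreover have "0 \<le> (\<integral>\<omega>. (SUP t\<in>{0..1}. R t \<omega>) powr p \<partial>completion N) * Lp_mixed_volume p L K"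
    using VK by simp
  ultimately have "(\<integral>\<omega>. Lp_mixed_volume p L (?Z \<omega>) \<partial>completion M) =
      (\<integral>\<omega>. (SUP t\<in>{0..1}. R t \<omega>) powr p \<partial>completion N) * Lp_mixed_volume p L K"
    by (simp only: ennreal_inj)
  with IX(1)[OF fin] IR(1) show ?thesis by simp
qed

end
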